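(* Let $\Omega\subseteq\Gamma$ be finite, contain $e$, and generate $\Gamma$ as a semigroup, and let $\mathcal Y=(Y_n)_{n\ge1}$ be an increasing sequence of finite subsets of $\Gamma$ with $\bigcup_n Y_n=\Gamma$. Then $\mathcal J_{\mathcal Y}({\sf BDO}(\Gamma))$ is the smallest closed ideal of $\mathcal S_{\mathcal Y}({\sf BDO}(\Gamma))$ which contains all sequences $(P_{Y_n}L_{\omega^{-1}}Q_{Y_n}L_\omega P_{Y_n})_{n\ge1}$ with $\omega\in\Omega$.
   Context: $\Gamma$ is a countable discrete group with identity $e$. For $X\subseteq\Gamma$, $l^2(X)$ is regarded as a closed subspace of $l^2(\Gamma)$, $P_X$ is the orthogonal projection of $l^2(\Gamma)$ onto $l^2(X)$ ($P_\emptyset=0$, $P_\Gamma=I$), and $Q_X:=I-P_X$. For $r\in\Gamma$, $(L_ru)(t)=u(r^{-1}t)$ on $l^2(\Gamma)$. ${\sf BDO}(\Gamma)$ is the smallest closed subalgebra of $L(l^2(\Gamma))$ containing all $L_r$ and all multiplication operators $aI$, $a\in l^\infty(\Gamma)$. $\Omega$ generates $\Gamma$ as a semigroup means every element of $\Gamma$ is a finite product of elements of $\Omega$. $\mathcal F_{\mathcal Y}$ is the $C^*$-algebra of all bounded sequences $(A_n)$ of operators $A_n:\mathrm{im}\,P_{Y_n}\to\mathrm{im}\,P_{Y_n}$, with componentwise operations and supremum norm. $\mathcal S_{\mathcal Y}({\sf BDO}(\Gamma))$ is the smallest closed $C^*$-subalgebra of $\mathcal F_{\mathcal Y}$ containing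 all sequences $(P_{Y_n}AP_{Y_n})$ with $A\in{\sf BDO}(\Gamma)$. For every $(A_n)$ in this algebra the strong limit $W((A_n)):=\mathrm{s\text{-}lim}\,A_nP_{Y_n}$ exists, and $\mathcal J_{\mathcal Y}({\sf BDO}(\Gamma)):=\{(A_n)\in\mathcal S_{\mathcal Y}({\sf BDO}(\Gamma)): W((A_n))=0\}$. *)

theory Defs
  imports "HOL-Analysis.Analysis" "HOL-Library.Countable"
begin

text \<open>The group \<Gamma> is a type of class group_add (not necessarily commutative),
  written additively: e = 0, r^{-1} = -r, product r s = r + s.
  Vectors of l^2(\<Gamma>) are functions \<Gamma> \<Rightarrow> complex that are square summable.
  Operators are functions on all of \<Gamma> \<Rightarrow> complex which are required to vanish
  off l^2 (so that equality of operators is plain function equality).\<close>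

type_synonym 'a op = "('a \<Rightarrow> complex) \<Rightarrow> ('a \<Rightarrow> complex)"

definition l2 :: "('a \<Rightarrow> complex) set" where
  "l2 = {u. (\<lambda>t. (cmod (u t))\<^sup>2) summable_on UNIV}"

definition l2norm :: "('a \<Rightarrow> complex) \<Rightarrow> real" where
  "l2norm u = sqrt (\<Sum>\<^sub>\<infinity>t. (cmod (u t))\<^sup>2)"

definition l2inner :: "('a \<Rightarrow> complex) \<Rightarrow> ('a \<Rightarrow> complex) \<Rightarrow> complex" where
  "l2inner u v = (\<Sum>\<^sub>\<infinity>t. u t * cnj (v t))"

definition bounded_op :: "'a op \<Rightarrow> bool" where
  "bounded_op A \<longleftrightarrow>
     (\<forall>u\<in>l2. A u \<in> l2) \<and> (\<forall>u. u \<notin> l2 \<longrightarrow> A u = (\<lambda>_. 0)) \<and>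
     (\<forall>u\<in>l2. \<forall>v\<in>l2. \<forall>c. A (\<lambda>t. c * u t + v t) = (\<lambda>t. c * A u t + A v t)) \<and>
     (\<exists>C. \<forall>u\<in>l2. l2norm (A u) \<le> C * l2norm u)"

definition opnorm :: "'a op \<Rightarrow> real" where
  "opnorm A = Sup ((\<lambda>u. l2norm (A u)) ` {u\<in>l2. l2norm u \<le> 1})"

definition op_add :: "'a op \<Rightarrow> 'a op \<Rightarrow> 'a op" where
  "op_add A B = (\<lambda>u t. A u t + B u t)"

definition op_diff :: "'a op \<Rightarrow> 'a op \<Rightarrow> 'a op" where
  "op_diff A B = (\<lambda>u t. A u t - B u t)"

definition op_scale :: "complex \<Rightarrow> 'a op \<Rightarrow> 'a op" where
  "op_scale c A = (\<lambda>u t. c * A u t)"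

definition op_adj :: "'a op \<Rightarrow> 'a op" where
  "op_adj A = (THE B. bounded_op B \<and>
      (\<forall>u\<in>l2. \<forall>v\<in>l2. l2inner (A u) v = l2inner u (B v)))"

definition Id_op :: "'a op" where
  "Id_op = (\<lambda>u. if u \<in> l2 then u else (\<lambda>_. 0))"

definition mult_op :: "('a \<Rightarrow> complex) \<Rightarrow> 'a op" where
  "mult_op a = (\<lambda>u. if u \<in> l2 then (\<lambda>t. a t * u t) else (\<lambda>_. 0))"

definition shift_op :: "'a::group_add \<Rightarrow> 'a op" where
  "shift_op r = (\<lambda>u. if u \<in> l2 then (\<lambda>t. u (- r + t)) else (\<lambda>_. 0))"

definition P_op :: "'a set \<Rightarrow> 'a op" where
  "P_op X = (\<lambda>u. if u \<in> l2 then (\<lambda>t. if t \<in> X then u t else 0) else (\<lambda>_. 0))"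

definition Q_op :: "'a set \<Rightarrow> 'a op" where
  "Q_op X = op_diff Id_op (P_op X)"

definition linfty :: "('a \<Rightarrow> complex) set" where
  "linfty = {a. \<exists>C. \<forall>t. cmod (a t) \<le> C}"

definition op_closed :: "'a op set \<Rightarrow> bool" where
  "op_closed C \<longleftrightarrow> (\<forall>f B. (\<forall>k. f k \<in> C) \<and> bounded_op B \<and>
      (\<lambda>k. opnorm (op_diff (f k) B)) \<longlonglongrightarrow> 0 \<longrightarrow> B \<in> C)"

definition op_subalg :: "'a op set \<Rightarrow> bool" where
  "op_subalg C \<longleftrightarrow> C \<subseteq> {A. bounded_op A} \<and>
     (\<forall>A\<in>C. \<forall>B\<in>C. op_add A B \<in> C \<and> A \<circ> B \<in> C) \<and>
     (\<forall>c. \<forall>A\<in>C. op_scale c A \<in> C)"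

definition BDO :: "('a::group_add) op set" where
  "BDO = \<Inter>{C. op_subalg C \<and> op_closed C \<and>
        (\<forall>r. shift_op r \<in> C) \<and> (\<forall>a\<in>linfty. mult_op a \<in> C)}"

text \<open>The algebra F_Y of bounded sequences (A_n) of operators on im P_{Y_n};
  an operator on im P_{Y_n} is identified with the operator P_{Y_n} A P_{Y_n}
  on l^2(\<Gamma>).  Sequences are indexed by nat.\<close>
type_synonym 'a opseq = "nat \<Rightarrow> 'a op"

definition FY :: "(nat \<Rightarrow> 'a set) \<Rightarrow> 'a opseq set" where
  "FY Y = {A. (\<forall>n. bounded_op (A n) \<and> P_op (Y n) \<circ> A n \<circ> P_op (Y n) = A n) \<and>
              bdd_above (range (\<lambda>n. opnorm (A n)))}"

definition seqnorm :: "'a opseq \<Rightarrow> real" where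
  "seqnorm A = (SUP n. opnorm (A n))"

definition seq_add :: "'a opseq \<Rightarrow> 'a opseq \<Rightarrow> 'a opseq" where
  "seq_add A B = (\<lambda>n. op_add (A n) (B n))"

definition seq_diff :: "'a opseq \<Rightarrow> 'a opseq \<Rightarrow> 'a opseq" where
  "seq_diff A B = (\<lambda>n. op_diff (A n) (B n))"

definition seq_scale :: "complex \<Rightarrow> 'a opseq \<Rightarrow> 'a opseq" where
  "seq_scale c A = (\<lambda>n. op_scale c (A n))"

definition seq_mult :: "'a opseq \<Rightarrow> 'a opseq \<Rightarrow> 'a opseq" where
  "seq_mult A B = (\<lambda>n. A n \<circ> B n)"

definition seq_adj :: "'a opseq \<Rightarrow> 'a opseq" where
  "seq_adj A = (\<lambda>n. op_adj (A n))"

definition seq_closed :: "(nat \<Rightarrow> 'a set) \<Rightarrow> 'a opseq set \<Rightarrow> bool" where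
  "seq_closed Y C \<longleftrightarrow> (\<forall>f B. (\<forall>k. f k \<in> C) \<and> B \<in> FY Y \<and>
      (\<lambda>k. seqnorm (seq_diff (f k) B)) \<longlonglongrightarrow> 0 \<longrightarrow> B \<in> C)"

definition cstar_subalg :: "(nat \<Rightarrow> 'a set) \<Rightarrow> 'a opseq set \<Rightarrow> bool" where
  "cstar_subalg Y C \<longleftrightarrow> C \<subseteq> FY Y \<and>
     (\<forall>A\<in>C. \<forall>B\<in>C. seq_add A B \<in> C \<and> seq_mult A B \<in> C) \<and>
     (\<forall>c. \<forall>A\<in>C. seq_scale c A \<in> C) \<and> (\<forall>A\<in>C. seq_adj A \<in> C)"

definition SY :: "(nat \<Rightarrow> 'a::group_add set) \<Rightarrow> 'a opseq set" where
  "SY Y = \<Inter>{C. cstar_subalg Y C \<and> seq_closed Y C \<and>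
      (\<forall>A\<in>BDO. (\<lambda>n. P_op (Y n) \<circ> A \<circ> P_op (Y n)) \<in> C)}"

definition strong_lim :: "'a opseq \<Rightarrow> 'a op \<Rightarrow> bool" where
  "strong_lim A W \<longleftrightarrow> (\<forall>u\<in>l2. (\<lambda>n. l2norm (\<lambda>t. A n u t - W u t)) \<longlonglongrightarrow> 0)"

definition JY :: "(nat \<Rightarrow> 'a::group_add set) \<Rightarrow> 'a opseq set" where
  "JY Y = {A \<in> SY Y. strong_lim (\<lambda>n. A n \<circ> P_op (Y n)) (\<lambda>_ _. 0)}"

definition closed_ideal :: "(nat \<Rightarrow> 'a set) \<Rightarrow> 'a opseq set \<Rightarrow> 'a opseq set \<Rightarrow> bool" where
  "closed_ideal Y S I \<longleftrightarrow> I \<subseteq> S \<and>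
     (\<forall>A\<in>I. \<forall>B\<in>I. seq_add A B \<in> I) \<and> (\<forall>c. \<forall>A\<in>I. seq_scale c A \<in> I) \<and>
     (\<forall>A\<in>I. \<forall>B\<in>S. seq_mult A B \<in> I \<and> seq_mult B A \<in> I) \<and>
     seq_closed Y I"

definition generates_semigroup :: "'a::monoid_add set \<Rightarrow> bool" where
  "generates_semigroup \<Omega> \<longleftrightarrow> (\<forall>g. \<exists>xs. xs \<noteq> [] \<and> set xs \<subseteq> \<Omega> \<and> g = sum_list xs)"

end

theory Submission
  imports Defs
begin

text \<open>
  Write \<open>D(B) = (P\<^sub>n B P\<^sub>n)\<close> and \<open>H(B,C) = (P\<^sub>n B Q\<^sub>n C P\<^sub>n) = D(BC) - D(B)D(C)\<close>. Let \<open>I\<close> be a closed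
  ideal containing the generators \<open>H(L\<^bsub>-\<omega>\<^esub>, L\<^sub>\<omega>)\<close>. As \<open>Q\<^sub>n L\<^sub>\<omega> P\<^sub>n\<close> is a partial isometry,
  \<open>H(B, L\<^sub>\<omega>) = H(B, L\<^sub>\<omega>) H(L\<^bsub>-\<omega>\<^esub>, L\<^sub>\<omega>)\<close> lies in \<open>I\<close>, and the identity
  \<open>H(B,CC') = H(B,C)D(C') + H(BC,C') - D(B)H(C,C')\<close> shows that the band-dominated \<open>C\<close> with
  \<open>H(B,C) \<in> I\<close> for all \<open>B\<close> form a closed algebra, hence are all of BDO. Therefore \<open>D\<close> is
  multiplicative modulo the strongly null elements of \<open>I\<close>, and the sums \<open>D(B) + K\<close> with such \<open>K\<close>
  are dense in the whole algebra. If a strongly null sequence is within \<open>\<epsilon>\<close> of \<open>D(B) + K\<close>,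
  then the strong limit \<open>B\<close> of the difference has norm at most \<open>\<epsilon>\<close>, so the sequence is within
  \<open>2\<epsilon>\<close> of \<open>K \<in> I\<close>. Applied with \<open>I\<close> the whole algebra, the same density yields that the strongly
  null sequences form an ideal.
\<close>

section \<open>The Hilbert space of square summable functions\<close>

text \<open>Finite partial sums of nonnegative terms control both summability and the value of the
  sum. The triangle inequality, monotonicity and the bound for the adjoint thereby reduce to
  inequalities for \<open>L2_set\<close> on finite sets.\<close>

lemma l2_boundI:
  assumes "\<And>F. finite F \<Longrightarrow> L2_set (\<lambda>t. cmod (u t)) F \<le> C"
  shows "u \<in> l2" and "l2norm u \<le> C"
proof -
  have C: "C \<ge> 0" using assms[of "{}"] by simp
  have bd: "(\<Sum>t\<in>F. (cmod (u t))\<^sup>2) \<le> C\<^sup>2" if "finite F" for F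
    using assms[OF that] real_sqrt_le_iff[of "\<Sum>t\<in>F. (cmod (u t))\<^sup>2" "C\<^sup>2"] C
    by (simp add: L2_set_def)
  have s: "(\<lambda>t. (cmod (u t))\<^sup>2) summable_on UNIV"
    by (rule nonneg_bdd_above_summable_on) (auto intro!: bdd_aboveI[of _ "C\<^sup>2"] bd)
  then show "u \<in> l2" by (simp add: l2_def)
  have "(\<Sum>\<^sub>\<infinity>t. (cmod (u t))\<^sup>2) \<le> C\<^sup>2"
    by (rule infsum_le_finite_sums[OF s]) (auto intro: bd)
  then show "l2norm u \<le> C"
    using C real_sqrt_le_mono[of _ "C\<^sup>2"] by (force simp: l2norm_def)
qed

lemma L2_set_le_l2norm:
  assumes "u \<in> l2" "finite F"
  shows "L2_set (\<lambda>t. cmod (u t)) F \<le> l2norm u"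
  unfolding L2_set_def l2norm_def
  using assms by (intro real_sqrt_le_mono finite_sum_le_infsum) (auto simp: l2_def)

lemma l2norm_nonneg [simp]: "l2norm u \<ge> 0"
  by (simp add: l2norm_def infsum_nonneg)

lemma l2_mono:
  assumes "v \<in> l2" "\<And>t. cmod (u t) \<le> cmod (v t)"
  shows "u \<in> l2" and "l2norm u \<le> l2norm v"
proof -
  have "L2_set (\<lambda>t. cmod (u t)) F \<le> l2norm v" if "finite F" for F
    using L2_set_le_l2norm[OF assms(1) that] L2_set_mono[of F "\<lambda>t. cmod (u t)" "\<lambda>t. cmod (v t)"] assms(2)
    by auto
  then show "u \<in> l2" "l2norm u \<le> l2norm v"
    by (blast intro: l2_boundI)+
qed

lemma l2_add:
  assumes "u \<in> l2" "v \<in> l2"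
  shows "(\<lambda>t. u t + v t) \<in> l2" and "l2norm (\<lambda>t. u t + v t) \<le> l2norm u + l2norm v"
proof -
  have "L2_set (\<lambda>t. cmod (u t + v t)) F \<le> l2norm u + l2norm v" if "finite F" for F
  proof -
    have "L2_set (\<lambda>t. cmod (u t + v t)) F \<le> L2_set (\<lambda>t. cmod (u t) + cmod (v t)) F"
      by (intro L2_set_mono) (auto intro: norm_triangle_ineq)
    also have "\<dots> \<le> L2_set (\<lambda>t. cmod (u t)) F + L2_set (\<lambda>t. cmod (v t)) F"
      by (rule L2_set_triangle_ineq)
    finally show ?thesis
      using L2_set_le_l2norm[OF assms(1) that] L2_set_le_l2norm[OF assms(2) that] by linarith
  qed
  then show "(\<lambda>t. u t + v t) \<in> l2" "l2norm (\<lambda>t. u t + v t) \<le> l2norm u + l2norm v"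
    by (blast intro: l2_boundI)+
qed

lemma l2norm_mult_bound:
  assumes "u \<in> l2" "C \<ge> 0" "\<And>t. cmod (v t) \<le> C * cmod (u t)"
  shows "v \<in> l2" and "l2norm v \<le> C * l2norm u"
proof -
  have "L2_set (\<lambda>t. cmod (v t)) F \<le> C * l2norm u" if "finite F" for F
  proof -
    have "L2_set (\<lambda>t. cmod (v t)) F \<le> L2_set (\<lambda>t. C * cmod (u t)) F"
      by (intro L2_set_mono) (auto intro: assms)
    also have "\<dots> = C * L2_set (\<lambda>t. cmod (u t)) F"
      by (rule L2_set_right_distrib[symmetric]) (rule assms)
    finally show ?thesis
      using mult_left_mono[OF L2_set_le_l2norm[OF assms(1) that] assms(2)] by linarith
  qed
  then show "v \<in> l2" "l2norm v \<le> C * l2norm u"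
    by (blast intro: l2_boundI)+
qed

lemma l2_scale [simp]: "u \<in> l2 \<Longrightarrow> (\<lambda>t. c * u t) \<in> l2"
  by (rule l2norm_mult_bound(1)[of u "cmod c"]) (auto simp: norm_mult)

lemma l2norm_scale: "l2norm (\<lambda>t. c * u t) = cmod c * l2norm u"
  by (simp add: l2norm_def norm_mult power_mult_distrib infsum_cmult_right' real_sqrt_mult)

lemma l2norm_minus_commute: "l2norm (\<lambda>t. u t - v t) = l2norm (\<lambda>t. v t - u t)"
  by (simp add: l2norm_def norm_minus_commute)

lemma l2_zero [simp]: "(\<lambda>_. 0) \<in> l2"
  and l2norm_zero [simp]: "l2norm (\<lambda>_. 0) = 0"
  by (simp_all add: l2_def l2norm_def)

lemma l2_minus: "u \<in> l2 \<Longrightarrow> (\<lambda>t. - u t) \<in> l2"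
  using l2_mono(1)[of u "\<lambda>t. - u t"] by simp

lemma l2_diff:
  assumes "u \<in> l2" "v \<in> l2"
  shows "(\<lambda>t. u t - v t) \<in> l2" and "l2norm (\<lambda>t. u t - v t) \<le> l2norm u + l2norm v"
  using l2_add[OF assms(1) l2_minus[OF assms(2)]] by (simp_all add: l2norm_def)

lemma l2norm_triangle_sub:
  assumes "u \<in> l2" "v \<in> l2"
  shows "l2norm u \<le> l2norm v + l2norm (\<lambda>t. u t - v t)"
  using l2_add(2)[OF assms(2) l2_diff(1)[OF assms]] by simp

lemma P_op_l2 [simp]: "P_op X u \<in> l2"
  using l2_mono(1)[of u "P_op X u"] by (auto simp: P_op_def)

lemma l2norm_P_op: "u \<in> l2 \<Longrightarrow> l2norm (P_op X u) \<le> l2norm u"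
  using l2_mono(2)[of u "P_op X u"] by (auto simp: P_op_def)

text \<open>Formulated for every \<open>X\<close> containing \<open>F\<close>, so that it applies at
  once to all late members of an exhaustion.\<close>

lemma l2_tail_small:
  assumes "u \<in> l2" "\<epsilon> > 0"
  obtains F where "finite F" "\<And>X. F \<subseteq> X \<Longrightarrow> l2norm (\<lambda>t. u t - P_op X u t) < \<epsilon>"
proof -
  define S where "S = (\<Sum>\<^sub>\<infinity>t. (cmod (u t))\<^sup>2)"
  have s: "(\<lambda>t. (cmod (u t))\<^sup>2) summable_on UNIV" using assms(1) by (simp add: l2_def)
  then have "((\<lambda>t. (cmod (u t))\<^sup>2) has_sum S) UNIV" by (simp add: S_def)
  then have "(sum (\<lambda>t. (cmod (u t))\<^sup>2) \<longlongrightarrow> S) (finite_subsets_at_top UNIV)"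
    by (simp add: has_sum_def)
  \<comment> \<open>Half of \<epsilon> is used because finite partial sums only yield a nonstrict
    bound, while the conclusion is strict.\<close>
  then have "\<forall>\<^sub>F F in finite_subsets_at_top UNIV. S - (\<epsilon>/2)\<^sup>2 < (\<Sum>t\<in>F. (cmod (u t))\<^sup>2)"
    using assms(2) by (intro order_tendstoD) auto
  then obtain F where F: "finite F" "S - (\<epsilon>/2)\<^sup>2 < (\<Sum>t\<in>F. (cmod (u t))\<^sup>2)"
    by (auto simp: eventually_finite_subsets_at_top)
  show ?thesis
  proof (rule that[OF F(1)])
    fix X assume X: "F \<subseteq> X"
    have "L2_set (\<lambda>t. cmod (u t - P_op X u t)) G \<le> \<epsilon>/2" if "finite G" for G
    proof -
      have "(\<Sum>t\<in>G. (cmod (u t - P_op X u t))\<^sup>2) = (\<Sum>t\<in>G - X. (cmod (u t))\<^sup>2)"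
        using assms(1) that by (intro sum.mono_neutral_cong_right) (auto simp: P_op_def)
      \<comment> \<open>\<open>G - X\<close> and \<open>F\<close> are disjoint because
        \<open>F \<subseteq> X\<close>. Together they contribute at most \<open>S\<close>, and
        \<open>F\<close> alone already accounts for all but (\<epsilon>/2)^2 of it.\<close>
      also have "\<dots> + (\<Sum>t\<in>F. (cmod (u t))\<^sup>2) = (\<Sum>t\<in>(G - X) \<union> F. (cmod (u t))\<^sup>2)"
        using that F X by (intro sum.union_disjoint[symmetric]) auto
      also have "\<dots> \<le> S"
        unfolding S_def using that F by (intro finite_sum_le_infsum[OF s]) auto
      finally have "(\<Sum>t\<in>G. (cmod (u t - P_op X u t))\<^sup>2) \<le> (\<epsilon>/2)\<^sup>2"
        using F(2) by linarith
      then show ?thesis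
        using real_sqrt_le_mono[of _ "(\<epsilon>/2)\<^sup>2"] assms(2) by (fastforce simp: L2_set_def)
    qed
    then have "l2norm (\<lambda>t. u t - P_op X u t) \<le> \<epsilon>/2" by (rule l2_boundI(2))
    then show "l2norm (\<lambda>t. u t - P_op X u t) < \<epsilon>" using assms(2) by linarith
  qed
qed

section \<open>Inner product and basis vectors\<close>

text \<open>The finite Cauchy-Schwarz inequality bounds the partial sums of absolute values, which
  gives absolute summability and the bound for the infinite sum together.\<close>

lemma l2inner_summable:
  assumes "u \<in> l2" "v \<in> l2"
  shows "(\<lambda>t. u t * cnj (v t)) summable_on UNIV"
    and "cmod (l2inner u v) \<le> l2norm u * l2norm v"
proof -
  have bd: "(\<Sum>t\<in>F. cmod (u t * cnj (v t))) \<le> l2norm u * l2norm v" if "finite F" for F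
  proof -
    have "(\<Sum>t\<in>F. cmod (u t * cnj (v t))) = (\<Sum>t\<in>F. \<bar>cmod (u t)\<bar> * \<bar>cmod (v t)\<bar>)"
      by (simp add: norm_mult)
    also have "\<dots> \<le> L2_set (\<lambda>t. cmod (u t)) F * L2_set (\<lambda>t. cmod (v t)) F"
      by (rule L2_set_mult_ineq)
    also have "\<dots> \<le> l2norm u * l2norm v"
      using assms that by (intro mult_mono L2_set_le_l2norm) auto
    finally show ?thesis .
  qed
  have s: "(\<lambda>t. norm (u t * cnj (v t))) summable_on UNIV"
    by (rule nonneg_bdd_above_summable_on)
       (auto intro!: bdd_aboveI[of _ "l2norm u * l2norm v"] bd)
  then show "(\<lambda>t. u t * cnj (v t)) summable_on UNIV" by (rule abs_summable_summable)
  have "cmod (l2inner u v) \<le> (\<Sum>\<^sub>\<infinity>t. cmod (u t * cnj (v t)))"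
    unfolding l2inner_def by (rule norm_infsum_bound[OF s])
  also have "\<dots> \<le> l2norm u * l2norm v"
    by (rule infsum_le_finite_sums[OF s]) (auto intro: bd)
  finally show "cmod (l2inner u v) \<le> l2norm u * l2norm v" .
qed

lemma l2inner_lin_left:
  assumes "u \<in> l2" "v \<in> l2" "w \<in> l2"
  shows "l2inner (\<lambda>t. c * u t + v t) w = c * l2inner u w + l2inner v w"
proof -
  have "l2inner (\<lambda>t. c * u t + v t) w = (\<Sum>\<^sub>\<infinity>t. c * (u t * cnj (w t)) + v t * cnj (w t))"
    by (simp add: l2inner_def algebra_simps)
  also have "\<dots> = (\<Sum>\<^sub>\<infinity>t. c * (u t * cnj (w t))) + (\<Sum>\<^sub>\<infinity>t. v t * cnj (w t))"
    using assms by (intro infsum_add summable_on_cmult_right l2inner_summable)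
  finally show ?thesis by (simp add: l2inner_def infsum_cmult_right')
qed

lemma l2inner_cnj: "l2inner v u = cnj (l2inner u v)"
  by (simp add: l2inner_def mult.commute flip: infsum_cnj)

lemma l2inner_add_left:
  "u \<in> l2 \<Longrightarrow> v \<in> l2 \<Longrightarrow> w \<in> l2 \<Longrightarrow> l2inner (\<lambda>t. u t + v t) w = l2inner u w + l2inner v w"
  using l2inner_lin_left[of u v w 1] by simp

lemma l2inner_scale_left: "l2inner (\<lambda>t. c * u t) w = c * l2inner u w"
  by (simp add: l2inner_def mult.assoc infsum_cmult_right')

lemma l2inner_diff_left:
  "u \<in> l2 \<Longrightarrow> v \<in> l2 \<Longrightarrow> w \<in> l2 \<Longrightarrow> l2inner (\<lambda>t. u t - v t) w = l2inner u w - l2inner v w"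
  using l2inner_lin_left[of v u w "-1"] by simp

lemma l2inner_add_right:
  "u \<in> l2 \<Longrightarrow> v \<in> l2 \<Longrightarrow> w \<in> l2 \<Longrightarrow> l2inner w (\<lambda>t. u t + v t) = l2inner w u + l2inner w v"
  by (subst (1 2 3) l2inner_cnj) (simp add: l2inner_add_left)

lemma l2inner_scale_right: "l2inner w (\<lambda>t. c * u t) = cnj c * l2inner w u"
  by (subst (1 2) l2inner_cnj) (simp add: l2inner_scale_left)

lemma l2inner_unit: "l2inner (\<lambda>s. if s = t then 1 else 0) w = cnj (w t)"
proof -
  have "l2inner (\<lambda>s. if s = t then 1 else 0) w = (\<Sum>\<^sub>\<infinity>s\<in>{t}. cnj (w s))"
    unfolding l2inner_def by (intro infsum_cong_neutral) auto
  then show ?thesis by simp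
qed

lemma l2_finite_support: "finite F \<Longrightarrow> (\<And>t. t \<notin> F \<Longrightarrow> u t = 0) \<Longrightarrow> u \<in> l2"
  unfolding l2_def
  by (auto intro!: finite_nonzero_values_imp_summable_on elim!: finite_subset[rotated])
     blast

section \<open>Bounded operators and adjoints\<close>

lemma bounded_op_l2 [simp]: "bounded_op A \<Longrightarrow> A u \<in> l2"
  by (cases "u \<in> l2") (auto simp: bounded_op_def)

lemma bounded_op_off: "bounded_op A \<Longrightarrow> u \<notin> l2 \<Longrightarrow> A u = (\<lambda>_. 0)"
  by (simp add: bounded_op_def)

lemma bounded_op_lin:
  "bounded_op A \<Longrightarrow> u \<in> l2 \<Longrightarrow> v \<in> l2 \<Longrightarrow> A (\<lambda>t. c * u t + v t) = (\<lambda>t. c * A u t + A v t)"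
  by (simp add: bounded_op_def)

lemma bounded_op_zero [simp]: "bounded_op A \<Longrightarrow> A (\<lambda>_. 0) = (\<lambda>_. 0)"
  using bounded_op_lin[of A "\<lambda>_. 0" "\<lambda>_. 0" "-1"] by simp

lemma bounded_op_add:
  "bounded_op A \<Longrightarrow> u \<in> l2 \<Longrightarrow> v \<in> l2 \<Longrightarrow> A (\<lambda>t. u t + v t) = (\<lambda>t. A u t + A v t)"
  using bounded_op_lin[of A u v 1] by simp

lemma bounded_op_diff:
  "bounded_op A \<Longrightarrow> u \<in> l2 \<Longrightarrow> v \<in> l2 \<Longrightarrow> A (\<lambda>t. u t - v t) = (\<lambda>t. A u t - A v t)"
  using bounded_op_lin[of A v u "-1"] by simp

lemma bounded_op_scale:
  "bounded_op A \<Longrightarrow> u \<in> l2 \<Longrightarrow> A (\<lambda>t. c * u t) = (\<lambda>t. c * A u t)"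
  using bounded_op_lin[of A u "\<lambda>_. 0" c] by simp

lemma bounded_opI:
  assumes "\<And>u. u \<in> l2 \<Longrightarrow> A u \<in> l2" "\<And>u. u \<notin> l2 \<Longrightarrow> A u = (\<lambda>_. 0)"
    and "\<And>u v c t. u \<in> l2 \<Longrightarrow> v \<in> l2 \<Longrightarrow> A (\<lambda>t. c * u t + v t) t = c * A u t + A v t"
    and "\<And>u. u \<in> l2 \<Longrightarrow> l2norm (A u) \<le> C * l2norm u"
  shows "bounded_op A"
  unfolding bounded_op_def using assms by blast

lemma bounded_op_eqI:
  assumes "bounded_op A" "bounded_op B" "\<And>u t. u \<in> l2 \<Longrightarrow> A u t = B u t"
  shows "A = B"
  using assms by (metis bounded_op_off ext)

section \<open>The operator norm\<close>

lemma opnorm_leI: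
  assumes "\<And>u. u \<in> l2 \<Longrightarrow> l2norm (A u) \<le> C * l2norm u" "C \<ge> 0"
  shows "opnorm A \<le> C"
  unfolding opnorm_def
proof (rule cSup_least)
  show "(\<lambda>u. l2norm (A u)) ` {u \<in> l2. l2norm u \<le> 1} \<noteq> {}"
    using l2_zero l2norm_zero by fastforce
  fix x assume "x \<in> (\<lambda>u. l2norm (A u)) ` {u \<in> l2. l2norm u \<le> 1}"
  then show "x \<le> C"
    using assms by (auto intro: order_trans[OF assms(1) mult_left_le])
qed

text \<open>A real \<open>Sup\<close> is informative only for a set bounded above; this is shown
  first, with \<open>\<bar>C\<bar>\<close> because the sign of \<open>C\<close> is not known in
  advance. The estimate then follows by rescaling \<open>u\<close> to norm 1.\<close>

lemma opnorm_bound: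
  assumes "bounded_op A" "u \<in> l2"
  shows "l2norm (A u) \<le> opnorm A * l2norm u"
proof -
  obtain C where C: "\<And>u. u \<in> l2 \<Longrightarrow> l2norm (A u) \<le> C * l2norm u"
    using assms unfolding bounded_op_def by blast
  have bdd: "bdd_above ((\<lambda>u. l2norm (A u)) ` {u \<in> l2. l2norm u \<le> 1})"
  proof (rule bdd_aboveI[of _ "\<bar>C\<bar>"])
    fix x assume "x \<in> (\<lambda>u. l2norm (A u)) ` {u \<in> l2. l2norm u \<le> 1}"
    then obtain v where v: "x = l2norm (A v)" "v \<in> l2" "l2norm v \<le> 1" by auto
    have "C * l2norm v \<le> \<bar>C\<bar> * l2norm v" by (intro mult_right_mono) auto
    also have "\<dots> \<le> \<bar>C\<bar>" using v by (intro mult_left_le) auto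
    finally show "x \<le> \<bar>C\<bar>" using C[OF v(2)] v by linarith
  qed
  show ?thesis
  proof (cases "l2norm u = 0")
    case True
    \<comment> \<open>Rescaling is impossible here, but the raw bound \<open>C * l2norm u\<close>
      already forces \<open>A u\<close> to have norm 0.\<close>
    then show ?thesis using C[OF assms(2)] by simp
  next
    case False
    then have pos: "l2norm u > 0" using l2norm_nonneg[of u] by linarith
    define c where "c = complex_of_real (1 / l2norm u)"
    have c: "cmod c = 1 / l2norm u" using pos by (simp add: c_def norm_divide)
    have "l2norm (A (\<lambda>t. c * u t)) \<le> opnorm A"
      unfolding opnorm_def using assms pos
      by (intro cSup_upper[OF _ bdd] imageI) (auto simp: l2norm_scale c)
    then have "l2norm (A u) / l2norm u \<le> opnorm A"
      using assms by (simp add: bounded_op_scale l2norm_scale c)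
    then show ?thesis using pos by (simp add: field_simps)
  qed
qed

text \<open>The estimate \<open>opnorm_bound\<close> is tested at a basis vector. One exists because
  types are inhabited, and its norm is at least 1, so the sign of \<open>opnorm A\<close> can be
  read off.\<close>

lemma opnorm_nonneg [simp]:
  fixes A :: "'a op"
  assumes "bounded_op A"
  shows "opnorm A \<ge> 0"
proof -
  fix t :: 'a
  let ?e = "\<lambda>s. if s = t then 1 else 0 :: complex"
  have e: "?e \<in> l2" by (rule l2_finite_support[of "{t}"]) auto
  have "l2norm ?e \<ge> 1" using L2_set_le_l2norm[OF e, of "{t}"] by simp
  moreover have "0 \<le> opnorm A * l2norm ?e"
    using opnorm_bound[OF assms e] l2norm_nonneg[of "A ?e"] by linarith
  ultimately show ?thesis by (simp add: zero_le_mult_iff)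
qed

lemma bounded_op_op_add [simp]:
  assumes "bounded_op A" "bounded_op B"
  shows "bounded_op (op_add A B)"
proof (rule bounded_opI)
  show "l2norm (op_add A B u) \<le> (opnorm A + opnorm B) * l2norm u" if "u \<in> l2" for u
    using l2_add(2)[of "A u" "B u"] opnorm_bound[OF assms(1) that] opnorm_bound[OF assms(2) that] assms
    by (simp add: op_add_def algebra_simps)
qed (use assms in \<open>auto simp: op_add_def l2_add bounded_op_off bounded_op_lin distrib_left\<close>)

lemma bounded_op_op_scale [simp]:
  assumes "bounded_op A"
  shows "bounded_op (op_scale c A)"
proof (rule bounded_opI)
  show "l2norm (op_scale c A u) \<le> (cmod c * opnorm A) * l2norm u" if "u \<in> l2" for u
    using mult_left_mono[OF opnorm_bound[OF assms(1) that], of "cmod c"]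
    by (simp add: op_scale_def l2norm_scale algebra_simps)
qed (use assms in \<open>auto simp: op_scale_def bounded_op_off bounded_op_lin distrib_left\<close>)

lemma op_diff_conv: "op_diff A B = op_add A (op_scale (-1) B)"
  by (simp add: op_diff_def op_add_def op_scale_def)

lemma bounded_op_op_diff [simp]:
  "bounded_op A \<Longrightarrow> bounded_op B \<Longrightarrow> bounded_op (op_diff A B)"
  by (simp add: op_diff_conv)

lemma opnorm_comp_bound:
  assumes "bounded_op A" "bounded_op B" "u \<in> l2"
  shows "l2norm (A (B u)) \<le> opnorm A * opnorm B * l2norm u"
  using opnorm_bound[OF assms(1), of "B u"] assms
    mult_left_mono[OF opnorm_bound[OF assms(2,3)], of "opnorm A"]
  by (simp add: mult.assoc)

lemma bounded_op_comp [simp]: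
  assumes "bounded_op A" "bounded_op B"
  shows "bounded_op (A \<circ> B)"
proof (rule bounded_opI)
  show "l2norm ((A \<circ> B) u) \<le> (opnorm A * opnorm B) * l2norm u" if "u \<in> l2" for u
    using opnorm_comp_bound[OF assms that] by simp
qed (use assms in \<open>auto simp: bounded_op_off bounded_op_lin\<close>)

lemma bounded_op_P_op [simp]: "bounded_op (P_op X)"
  by (rule bounded_opI[where C = 1]) (auto simp: l2norm_P_op, auto simp: P_op_def l2_add)

lemma bounded_op_Id_op [simp]: "bounded_op Id_op"
  by (rule bounded_opI[where C = 1]) (auto simp: Id_op_def l2_add)

lemma bounded_op_Q_op [simp]: "bounded_op (Q_op X)"
  by (simp add: Q_op_def)

lemma Q_op_apply: "u \<in> l2 \<Longrightarrow> Q_op X u = (\<lambda>t. u t - P_op X u t)"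
  by (simp add: Q_op_def op_diff_def Id_op_def)

lemma l2norm_Q_op: "u \<in> l2 \<Longrightarrow> l2norm (Q_op X u) \<le> l2norm u"
  by (rule l2_mono(2)) (auto simp: Q_op_apply P_op_def)

lemma linftyE:
  assumes "a \<in> linfty"
  obtains C where "C \<ge> 0" "\<And>t. cmod (a t) \<le> C"
proof -
  obtain C where "\<And>t. cmod (a t) \<le> C" using assms unfolding linfty_def by blast
  then show ?thesis using order_trans[OF norm_ge_zero] that by blast
qed

lemma bounded_op_mult_op [simp]:
  assumes "a \<in> linfty"
  shows "bounded_op (mult_op a)"
proof -
  obtain C where C: "C \<ge> 0" "\<And>t. cmod (a t) \<le> C" using linftyE[OF assms] by blast
  have *: "(\<lambda>t. a t * u t) \<in> l2" "l2norm (\<lambda>t. a t * u t) \<le> C * l2norm u" if "u \<in> l2" for u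
    using that C by (auto intro!: l2norm_mult_bound[of u C] simp: norm_mult mult_right_mono)
  show ?thesis
    by (rule bounded_opI[where C = C]) (auto simp: mult_op_def * l2_add, simp add: algebra_simps)
qed

lemma bij_shift: "bij (\<lambda>t. - r + t :: 'a::group_add)"
  by (rule bijI') (auto intro: exI[of _ "r + _"] simp: algebra_simps add.assoc[symmetric])

lemma shift_l2:
  "u \<in> l2 \<Longrightarrow> (\<lambda>t. u (- r + t)) \<in> l2" "l2norm (\<lambda>t. u (- r + t)) = l2norm u"
  for r :: "'a::group_add"
  using summable_on_reindex_bij_betw[OF bij_shift[of r], of "\<lambda>t. (cmod (u t))\<^sup>2"]
    infsum_reindex_bij_betw[OF bij_shift[of r], of "\<lambda>t. (cmod (u t))\<^sup>2"]
  by (auto simp: l2_def l2norm_def)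

lemma bounded_op_shift_op [simp]: "bounded_op (shift_op r)"
  by (rule bounded_opI[where C = 1]) (auto simp: shift_op_def shift_l2 l2_add)

section \<open>Adjoints\<close>

lemma bounded_op_finite_support:
  assumes "bounded_op A" "finite F"
  shows "A (\<lambda>s. if s \<in> F then x s else 0) = (\<lambda>s. \<Sum>t\<in>F. x t * A (\<lambda>s. if s = t then 1 else 0) s)"
  using assms(2)
proof induction
  case (insert a F)
  let ?e = "\<lambda>s. if s = a then 1 else 0 :: complex" and ?x = "\<lambda>s. if s \<in> F then x s else 0"
  have l: "?e \<in> l2" "?x \<in> l2"
    using l2_finite_support[of "{a}" ?e] l2_finite_support[OF insert(1), of ?x] by simp_all
  have "(\<lambda>s. if s \<in> insert a F then x s else 0) = (\<lambda>s. x a * ?e s + ?x s)"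
    using insert by auto
  then show ?case
    using bounded_op_lin[OF assms(1) l, of "x a"] insert by simp
qed (use assms in simp)

text \<open>Membership in \<open>l2\<close> is carried along with the formula because additivity of
  \<open>l2inner\<close> in the induction step requires it.\<close>

lemma l2inner_sum_left:
  assumes "finite F" "\<And>t. t \<in> F \<Longrightarrow> f t \<in> l2" "w \<in> l2"
  shows "(\<lambda>s. \<Sum>t\<in>F. x t * f t s) \<in> l2
    \<and> l2inner (\<lambda>s. \<Sum>t\<in>F. x t * f t s) w = (\<Sum>t\<in>F. x t * l2inner (f t) w)"
  using assms(1,2)
proof induction
  case (insert a F)
  then show ?case
    using assms(3) by (auto simp: l2_add l2inner_lin_left)
qed (simp add: l2inner_def)

text \<open>The adjoint is written down through its matrix entries, \<open>(B v) t = \<langle>v, A e\<^sub>t\<rangle>\<close>, which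
  avoids the Riesz representation theorem.\<close>

lemma adjoint_exists:
  assumes A: "bounded_op A"
  obtains B where "bounded_op B"
    "\<And>u v. u \<in> l2 \<Longrightarrow> v \<in> l2 \<Longrightarrow> l2inner (A u) v = l2inner u (B v)"
    "opnorm B \<le> opnorm A"
proof -
  define e where "e = (\<lambda>(t::'a) s. if s = t then 1 else 0 :: complex)"
  define B where "B = (\<lambda>v. if v \<in> l2 then (\<lambda>t. l2inner v (A (e t))) else (\<lambda>_. 0))"
  have fin: "l2inner (A (\<lambda>s. if s \<in> F then x s else 0)) v = (\<Sum>t\<in>F. x t * cnj (B v t))"
    if "finite F" "v \<in> l2" for F x v
    unfolding bounded_op_finite_support[OF A that(1)]
    using l2inner_sum_left[OF that(1), of "\<lambda>t. A (e t)" v x] A that(2)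
    by (simp add: e_def B_def l2inner_cnj[of _ v])
  \<comment> \<open>Duality argument: let \<open>x\<close> be the truncation of \<open>B v\<close>
    to \<open>F\<close> and \<open>r\<close> its norm. Pairing \<open>A x\<close> with
    \<open>v\<close> gives r^2 \<le> opnorm A * r * l2norm v, and one factor \<open>r\<close>
    cancels.\<close>
  have bd: "L2_set (\<lambda>t. cmod (B v t)) F \<le> opnorm A * l2norm v" if F: "finite F" and v: "v \<in> l2" for F v
  proof -
    define x where "x = (\<lambda>s. if s \<in> F then B v s else 0)"
    define r where "r = L2_set (\<lambda>t. cmod (B v t)) F"
    have xl: "x \<in> l2" unfolding x_def by (rule l2_finite_support[OF F]) auto
    have r2: "r\<^sup>2 = (\<Sum>t\<in>F. (cmod (B v t))\<^sup>2)"
      by (simp add: r_def L2_set_def sum_nonneg)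
    have "(\<Sum>\<^sub>\<infinity>t. (cmod (x t))\<^sup>2) = (\<Sum>\<^sub>\<infinity>t\<in>F. (cmod (B v t))\<^sup>2)"
      by (intro infsum_cong_neutral) (auto simp: x_def)
    then have xr: "l2norm x = r"
      using F by (simp add: l2norm_def r_def L2_set_def)
    have "l2inner (A x) v = (\<Sum>t\<in>F. B v t * cnj (B v t))"
      using fin[OF F v, of "B v"] by (simp add: x_def)
    also have "\<dots> = complex_of_real (r\<^sup>2)"
      unfolding r2 of_real_sum by (intro sum.cong refl) (simp only: complex_norm_square)
    finally have "r\<^sup>2 = cmod (l2inner (A x) v)" by (simp add: norm_power)
    also have "\<dots> \<le> l2norm (A x) * l2norm v"
      using A v by (intro l2inner_summable) auto
    also have "\<dots> \<le> (opnorm A * r) * l2norm v"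
      using opnorm_bound[OF A xl] by (intro mult_right_mono) (auto simp: xr)
    finally have "r * r \<le> (opnorm A * l2norm v) * r" by (simp add: power2_eq_square algebra_simps)
    moreover have "r \<ge> 0" by (simp add: r_def)
    ultimately have "r \<le> opnorm A * l2norm v"
      using A by (cases "r = 0") (auto dest: mult_right_le_imp_le)
    then show ?thesis by (simp add: r_def)
  qed
  have Bl: "B v \<in> l2" "l2norm (B v) \<le> opnorm A * l2norm v" if "v \<in> l2" for v
    using l2_boundI[of "B v", OF bd[OF _ that]] by auto
  have Bb: "bounded_op B"
    by (rule bounded_opI[where C = "opnorm A"])
       (use A in \<open>auto simp: Bl, auto simp: B_def l2inner_lin_left l2_add\<close>)
  have eq: "l2inner (A u) v = l2inner u (B v)" if u: "u \<in> l2" and v: "v \<in> l2" for u v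
  proof -
    \<comment> \<open>The identity holds for finitely supported vectors by \<open>fin\<close>, and
      passes to \<open>u\<close> by truncation. \<open>K\<close> dominates the factor of
      \<open>l2norm d\<close> in the error; its summand 1 makes it positive, so that \<epsilon> / K
      is a legitimate tolerance.\<close>
    define K where "K = opnorm A * l2norm v + l2norm (B v) + 1"
    have K: "K > 0" using A by (simp add: K_def add_nonneg_pos)
    have "cmod (l2inner (A u) v - l2inner u (B v)) \<le> 0 + \<epsilon>" if \<epsilon>: "\<epsilon> > 0" for \<epsilon>
    proof -
      obtain F where F: "finite F" "\<And>X. F \<subseteq> X \<Longrightarrow> l2norm (\<lambda>t. u t - P_op X u t) < \<epsilon> / K"
        using l2_tail_small[OF u, of "\<epsilon> / K"] \<epsilon> K by auto
      define x where "x = P_op F u"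
      have x: "x = (\<lambda>s. if s \<in> F then u s else 0)" and xl: "x \<in> l2"
        using u by (simp_all add: x_def) (simp add: P_op_def)
      have "l2inner x (B v) = (\<Sum>\<^sub>\<infinity>t\<in>F. u t * cnj (B v t))"
        unfolding l2inner_def by (intro infsum_cong_neutral) (auto simp: x)
      then have eqx: "l2inner (A x) v = l2inner x (B v)"
        using fin[OF F(1) v, of u] F(1) by (simp add: x)
      define d where "d = (\<lambda>t. u t - x t)"
      have dl: "d \<in> l2" and dn: "l2norm d \<le> \<epsilon> / K"
        using u xl F(2)[of F] by (auto simp: d_def x_def l2_diff)
      have "l2inner (A u) v - l2inner u (B v) = l2inner (A d) v - l2inner d (B v)"
        using A Bl v u xl eqx by (simp add: d_def bounded_op_diff l2inner_diff_left)
      also have "cmod \<dots> \<le> l2norm (A d) * l2norm v + l2norm d * l2norm (B v)"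
        using A v dl Bl(1)[OF v]
        by (intro order_trans[OF norm_triangle_ineq4] add_mono l2inner_summable) auto
      also have "\<dots> \<le> (opnorm A * l2norm d) * l2norm v + l2norm d * l2norm (B v)"
        using opnorm_bound[OF A dl] by (intro add_right_mono mult_right_mono) auto
      also have "\<dots> = l2norm d * (opnorm A * l2norm v + l2norm (B v))"
        by (simp add: algebra_simps)
      also have "\<dots> \<le> l2norm d * K" by (intro mult_left_mono) (auto simp: K_def)
      also have "\<dots> \<le> (\<epsilon> / K) * K" using dn K by (intro mult_right_mono) auto
      also have "\<dots> = \<epsilon>" using K by simp
      finally show ?thesis by simp
    qed
    then have "cmod (l2inner (A u) v - l2inner u (B v)) \<le> 0" by (rule field_le_epsilon)
    then show ?thesis by simp
  qed
  show ?thesis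
    by (rule that[OF Bb eq opnorm_leI]) (use Bl A in auto)
qed

lemma l2inner_eqD:
  fixes v w :: "'a \<Rightarrow> complex"
  assumes "\<And>u. u \<in> l2 \<Longrightarrow> l2inner u v = l2inner u w"
  shows "v = w"
proof
  fix t :: 'a
  have "(\<lambda>s. if s = t then 1 else 0 :: complex) \<in> l2"
    by (rule l2_finite_support[of "{t}"]) auto
  from assms[OF this] show "v t = w t" by (simp add: l2inner_unit)
qed

text \<open>The description defining \<open>op_adj\<close> is unambiguous since testing against
  basis vectors determines each \<open>B v\<close>. Computing an adjoint thus amounts to exhibiting
  a bounded operator with the pairing property.\<close>

lemma op_adjI:
  fixes A B :: "'a op"
  assumes "bounded_op A" "bounded_op B"
    and "\<And>u v. u \<in> l2 \<Longrightarrow> v \<in> l2 \<Longrightarrow> l2inner (A u) v = l2inner u (B v)"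
  shows "op_adj A = B"
  unfolding op_adj_def
proof (rule the_equality)
  fix B' :: "'a op"
  assume B': "bounded_op B' \<and> (\<forall>u\<in>l2. \<forall>v\<in>l2. l2inner (A u) v = l2inner u (B' v))"
  show "B' = B"
  proof (rule bounded_op_eqI)
    fix v :: "'a \<Rightarrow> complex" and t assume "v \<in> l2"
    then have "B' v = B v" using assms B' by (intro l2inner_eqD) metis
    then show "B' v t = B v t" by simp
  qed (use assms B' in auto)
qed (use assms in auto)

lemma op_adj:
  assumes "bounded_op A"
  shows bounded_op_adj [simp]: "bounded_op (op_adj A)"
    and op_adj_inner: "u \<in> l2 \<Longrightarrow> v \<in> l2 \<Longrightarrow> l2inner (A u) v = l2inner u (op_adj A v)"
    and opnorm_adj_le: "opnorm (op_adj A) \<le> opnorm A"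
proof -
  obtain B where B: "bounded_op B"
    "\<And>u v. u \<in> l2 \<Longrightarrow> v \<in> l2 \<Longrightarrow> l2inner (A u) v = l2inner u (B v)" "opnorm B \<le> opnorm A"
    using adjoint_exists[OF assms] by blast
  have eq: "op_adj A = B" by (rule op_adjI) (use assms B in auto)
  show "bounded_op (op_adj A)" "opnorm (op_adj A) \<le> opnorm A"
    "u \<in> l2 \<Longrightarrow> v \<in> l2 \<Longrightarrow> l2inner (A u) v = l2inner u (op_adj A v)"
    using B by (simp_all add: eq)
qed

lemma op_adj_inner_left:
  assumes "bounded_op A" "u \<in> l2" "v \<in> l2"
  shows "l2inner (op_adj A u) v = l2inner u (A v)"
  using op_adj_inner[OF assms(1,3,2)] by (metis l2inner_cnj)

lemma op_adj_op_adj: "bounded_op A \<Longrightarrow> op_adj (op_adj A) = A"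
  by (rule op_adjI) (auto simp: op_adj_inner_left)

lemma op_adj_add:
  "bounded_op A \<Longrightarrow> bounded_op B \<Longrightarrow> op_adj (op_add A B) = op_add (op_adj A) (op_adj B)"
  by (rule op_adjI) (simp_all, simp add: op_add_def l2inner_add_left l2inner_add_right op_adj_inner)

lemma op_adj_scale:
  "bounded_op A \<Longrightarrow> op_adj (op_scale c A) = op_scale (cnj c) (op_adj A)"
  by (rule op_adjI) (simp_all, simp add: op_scale_def l2inner_scale_left l2inner_scale_right op_adj_inner)

lemma op_adj_diff:
  "bounded_op A \<Longrightarrow> bounded_op B \<Longrightarrow> op_adj (op_diff A B) = op_diff (op_adj A) (op_adj B)"
  by (simp add: op_diff_conv op_adj_add op_adj_scale)

lemma op_adj_comp:
  "bounded_op A \<Longrightarrow> bounded_op B \<Longrightarrow> op_adj (A \<circ> B) = op_adj B \<circ> op_adj A"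
  by (rule op_adjI) (simp_all add: op_adj_inner)

lemma op_adj_P_op: "op_adj (P_op X) = P_op X"
  by (rule op_adjI) (simp_all, auto simp: P_op_def l2inner_def intro!: infsum_cong)

lemma op_adj_Id_op: "op_adj Id_op = Id_op"
  by (rule op_adjI) (simp_all, simp add: Id_op_def)

lemma op_adj_Q_op: "op_adj (Q_op X) = Q_op X"
  by (simp add: Q_op_def op_adj_diff op_adj_Id_op op_adj_P_op)

lemma op_adj_shift_op: "op_adj (shift_op r) = shift_op (- r)"
proof (rule op_adjI)
  fix u v :: "'a \<Rightarrow> complex" assume uv: "u \<in> l2" "v \<in> l2"
  show "l2inner (shift_op r u) v = l2inner u (shift_op (- r) v)"
    using infsum_reindex_bij_betw[OF bij_shift[of r], of "\<lambda>t. u t * cnj (v (r + t))"] uv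
    by (simp add: l2inner_def shift_op_def add.assoc[symmetric])
qed simp_all

lemma linfty_cnj: "a \<in> linfty \<Longrightarrow> (\<lambda>t. cnj (a t)) \<in> linfty"
  by (simp add: linfty_def)

lemma op_adj_mult_op: "a \<in> linfty \<Longrightarrow> op_adj (mult_op a) = mult_op (\<lambda>t. cnj (a t))"
  by (rule op_adjI) (simp_all add: linfty_cnj, simp add: mult_op_def l2inner_def mult_ac)

lemma opnorm_op_add:
  assumes "bounded_op A" "bounded_op B"
  shows "opnorm (op_add A B) \<le> opnorm A + opnorm B"
proof (rule opnorm_leI)
  show "l2norm (op_add A B u) \<le> (opnorm A + opnorm B) * l2norm u" if "u \<in> l2" for u
    using l2_add(2)[of "A u" "B u"] opnorm_bound[OF assms(1) that] opnorm_bound[OF assms(2) that] assms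
    by (simp add: op_add_def algebra_simps)
qed (use assms in simp)

lemma opnorm_op_scale:
  assumes "bounded_op A"
  shows "opnorm (op_scale c A) \<le> cmod c * opnorm A"
proof (rule opnorm_leI)
  show "l2norm (op_scale c A u) \<le> (cmod c * opnorm A) * l2norm u" if "u \<in> l2" for u
    using mult_left_mono[OF opnorm_bound[OF assms(1) that], of "cmod c"]
    by (simp add: op_scale_def l2norm_scale algebra_simps)
qed (use assms in simp)

lemma opnorm_comp:
  assumes "bounded_op A" "bounded_op B"
  shows "opnorm (A \<circ> B) \<le> opnorm A * opnorm B"
  by (rule opnorm_leI) (use opnorm_comp_bound[OF assms] assms in auto)

lemma P_op_P_op [simp]: "P_op X (P_op X u) = P_op X u"
  using P_op_l2[of X u] by (auto simp: P_op_def)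

section \<open>Band-dominated operators\<close>

text \<open>Serves as the induction principle for \<open>BDO\<close>: the property to be proved is
  encoded as the set \<open>C\<close>.\<close>

lemma BDO_subset:
  assumes "op_subalg C" "op_closed C" "\<And>r. shift_op r \<in> C" "\<And>a. a \<in> linfty \<Longrightarrow> mult_op a \<in> C"
  shows "BDO \<subseteq> C"
  using assms unfolding BDO_def by blast

lemma BDO_bounded [simp]: "A \<in> BDO \<Longrightarrow> bounded_op (A :: 'a::group_add op)"
  using BDO_subset[of "{A :: 'a op. bounded_op A}"]
  by (auto simp: op_subalg_def op_closed_def)

lemma BDO_add [simp]: "A \<in> BDO \<Longrightarrow> B \<in> BDO \<Longrightarrow> op_add A B \<in> BDO"
  and BDO_comp [simp]: "A \<in> BDO \<Longrightarrow> B \<in> BDO \<Longrightarrow> A \<circ> B \<in> BDO"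
  and BDO_scale [simp]: "A \<in> BDO \<Longrightarrow> op_scale c A \<in> BDO"
  and BDO_shift [simp]: "shift_op r \<in> BDO"
  and BDO_mult [simp]: "a \<in> linfty \<Longrightarrow> mult_op a \<in> BDO"
  unfolding BDO_def op_subalg_def by blast+

lemma BDO_closed:
  "(\<And>k. f k \<in> BDO) \<Longrightarrow> bounded_op B \<Longrightarrow> (\<lambda>k. opnorm (op_diff (f k) B)) \<longlonglongrightarrow> 0 \<Longrightarrow> B \<in> BDO"
  unfolding BDO_def op_closed_def by blast

text \<open>The definition of \<open>BDO\<close> mentions no adjoints. Self-adjointness follows
  because adjoints of the generators are generators, and taking adjoints is conjugate linear,
  antimultiplicative and norm-decreasing.\<close>

lemma BDO_adj:
  assumes "A \<in> BDO"
  shows "op_adj A \<in> BDO"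
proof -
  have "BDO \<subseteq> {A \<in> BDO. op_adj A \<in> BDO}"
  proof (rule BDO_subset)
    show "op_closed {A \<in> BDO. op_adj A \<in> BDO}"
      unfolding op_closed_def
    proof (intro allI impI, elim conjE)
      fix f B
      assume f: "\<forall>k. f k \<in> {A \<in> BDO. op_adj A \<in> BDO}" and B: "bounded_op B"
        and lim: "(\<lambda>k. opnorm (op_diff (f k) B)) \<longlonglongrightarrow> 0"
      have "(\<lambda>k. opnorm (op_diff (op_adj (f k)) (op_adj B))) \<longlonglongrightarrow> 0"
      proof (rule tendsto_sandwich[OF _ _ tendsto_const lim]; intro always_eventually allI)
        fix k
        have b: "bounded_op (f k)" using f by auto
        show "0 \<le> opnorm (op_diff (op_adj (f k)) (op_adj B))" using b B by simp
        show "opnorm (op_diff (op_adj (f k)) (op_adj B)) \<le> opnorm (op_diff (f k) B)"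
          using opnorm_adj_le[of "op_diff (f k) B"] b B by (simp add: op_adj_diff)
      qed
      then show "B \<in> {A \<in> BDO. op_adj A \<in> BDO}"
        using f B lim by (auto intro: BDO_closed[of f] BDO_closed[of "\<lambda>k. op_adj (f k)"])
    qed
  qed (auto simp: op_subalg_def op_adj_add op_adj_comp op_adj_scale op_adj_shift_op op_adj_mult_op linfty_cnj)
  then show ?thesis using assms by blast
qed

section \<open>Sequences of operators\<close>

lemma FY_bounded [simp]: "A \<in> FY Y \<Longrightarrow> bounded_op (A n)"
  by (simp add: FY_def)

text \<open>Idempotence of the projection splits the two-sided condition in \<open>FY\<close> into
  separate absorption laws on the left and on the right.\<close>

lemma FY_P:
  assumes "A \<in> FY Y"
  shows FY_P_left: "P_op (Y n) (A n u) = A n u" and FY_P_right: "A n (P_op (Y n) u) = A n u"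
proof -
  have *: "P_op (Y n) (A n (P_op (Y n) u)) = A n u" for u
    using assms unfolding FY_def by (auto dest!: spec[of _ n] dest: fun_cong)
  show "P_op (Y n) (A n u) = A n u" using *[of u] by (metis P_op_P_op)
  show "A n (P_op (Y n) u) = A n u" using *[of u] *[of "P_op (Y n) u"] by simp
qed

lemma FYI:
  assumes "\<And>n. bounded_op (A n)"
    and "\<And>n u. u \<in> l2 \<Longrightarrow> P_op (Y n) (A n u) = A n u"
    and "\<And>n u. u \<in> l2 \<Longrightarrow> A n (P_op (Y n) u) = A n u"
    and "\<And>n. opnorm (A n) \<le> C"
  shows "A \<in> FY Y"
proof -
  have "P_op (Y n) \<circ> A n \<circ> P_op (Y n) = A n" for n
    by (rule bounded_op_eqI) (use assms in auto)
  moreover have "bdd_above (range (\<lambda>n. opnorm (A n)))"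
    using assms(4) by (intro bdd_aboveI[of _ C]) auto
  ultimately show ?thesis using assms(1) by (simp only: FY_def mem_Collect_eq simp_thms)
qed

lemma opnorm_le_seqnorm: "A \<in> FY Y \<Longrightarrow> opnorm (A n) \<le> seqnorm A"
  unfolding seqnorm_def FY_def by (auto intro: cSUP_upper)

lemma seqnorm_leI: "(\<And>n. opnorm (A n) \<le> C) \<Longrightarrow> seqnorm A \<le> C"
  unfolding seqnorm_def by (rule cSUP_least) auto

lemma seqnorm_nonneg [simp]: "A \<in> FY Y \<Longrightarrow> seqnorm A \<ge> 0"
  using opnorm_le_seqnorm[of A Y 0] opnorm_nonneg[of "A 0"] FY_bounded[of A Y 0] by linarith

lemma seqnorm_bound:
  assumes "A \<in> FY Y" "u \<in> l2"
  shows "l2norm (A n u) \<le> seqnorm A * l2norm u"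
  using opnorm_bound[OF FY_bounded[OF assms(1)] assms(2), of n]
    mult_right_mono[OF opnorm_le_seqnorm[OF assms(1), of n] l2norm_nonneg[of u]] by linarith

lemma FY_add:
  assumes "A \<in> FY Y" "B \<in> FY Y"
  shows "seq_add A B \<in> FY Y" and "seqnorm (seq_add A B) \<le> seqnorm A + seqnorm B"
proof -
  have *: "opnorm (seq_add A B n) \<le> seqnorm A + seqnorm B" for n
    using opnorm_op_add[of "A n" "B n"] assms
      opnorm_le_seqnorm[OF assms(1), of n] opnorm_le_seqnorm[OF assms(2), of n]
    by (simp add: seq_add_def)
  show "seq_add A B \<in> FY Y"
    by (rule FYI[OF _ _ _ *]; use assms in \<open>simp add: seq_add_def\<close>;
        simp add: op_add_def bounded_op_add FY_P[OF assms(1)] FY_P[OF assms(2)])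
  show "seqnorm (seq_add A B) \<le> seqnorm A + seqnorm B" by (rule seqnorm_leI[OF *])
qed

lemma FY_scale:
  assumes "A \<in> FY Y"
  shows "seq_scale c A \<in> FY Y" and "seqnorm (seq_scale c A) \<le> cmod c * seqnorm A"
proof -
  have *: "opnorm (seq_scale c A n) \<le> cmod c * seqnorm A" for n
    using opnorm_op_scale[of "A n" c] assms
      mult_left_mono[OF opnorm_le_seqnorm[OF assms(1), of n] norm_ge_zero[of c]]
    by (simp add: seq_scale_def)
  show "seq_scale c A \<in> FY Y"
    by (rule FYI[OF _ _ _ *]; use assms in \<open>simp add: seq_scale_def\<close>;
        simp add: op_scale_def bounded_op_scale FY_P[OF assms(1)])
  show "seqnorm (seq_scale c A) \<le> cmod c * seqnorm A" by (rule seqnorm_leI[OF *])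
qed

lemma seq_diff_conv: "seq_diff A B = seq_add A (seq_scale (-1) B)"
  by (simp add: seq_diff_def seq_add_def seq_scale_def op_diff_conv)

lemma FY_diff [simp]: "A \<in> FY Y \<Longrightarrow> B \<in> FY Y \<Longrightarrow> seq_diff A B \<in> FY Y"
  by (simp add: seq_diff_conv FY_add FY_scale)

lemma seqnorm_diff_commute: "seqnorm (seq_diff A B) = seqnorm (seq_diff B A)"
proof -
  have "opnorm (op_diff C D) = opnorm (op_diff D C)" for C D :: "'a op"
    unfolding opnorm_def op_diff_def by (subst l2norm_minus_commute) simp
  then show ?thesis by (simp add: seqnorm_def seq_diff_def)
qed

lemma seqnorm_diff_triangle:
  assumes "A \<in> FY Y" "B \<in> FY Y" "C \<in> FY Y"
  shows "seqnorm (seq_diff A C) \<le> seqnorm (seq_diff A B) + seqnorm (seq_diff B C)"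
proof -
  have "seq_diff A C = seq_add (seq_diff A B) (seq_diff B C)"
    by (simp add: seq_diff_def seq_add_def op_diff_def op_add_def)
  then show ?thesis using FY_add(2)[of "seq_diff A B" Y "seq_diff B C"] assms by simp
qed

lemma seqnorm_le_diff:
  assumes "A \<in> FY Y" "B \<in> FY Y"
  shows "seqnorm A \<le> seqnorm B + seqnorm (seq_diff A B)"
proof -
  have "A = seq_add B (seq_diff A B)"
    by (simp add: seq_diff_def seq_add_def op_diff_def op_add_def)
  then show ?thesis using FY_add(2)[of B Y "seq_diff A B"] assms by simp
qed

lemma FY_mult:
  assumes "A \<in> FY Y" "B \<in> FY Y"
  shows "seq_mult A B \<in> FY Y" and "seqnorm (seq_mult A B) \<le> seqnorm A * seqnorm B"
proof -
  have *: "opnorm (seq_mult A B n) \<le> seqnorm A * seqnorm B" for n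
  proof -
    have "opnorm (seq_mult A B n) \<le> opnorm (A n) * opnorm (B n)"
      using assms by (simp add: seq_mult_def opnorm_comp)
    also have "\<dots> \<le> seqnorm A * seqnorm B"
      using assms by (intro mult_mono opnorm_le_seqnorm) auto
    finally show ?thesis .
  qed
  show "seq_mult A B \<in> FY Y"
    by (rule FYI[OF _ _ _ *]; use assms in \<open>simp add: seq_mult_def FY_P\<close>)
  show "seqnorm (seq_mult A B) \<le> seqnorm A * seqnorm B" by (rule seqnorm_leI[OF *])
qed

lemma FY_adj:
  assumes "A \<in> FY Y"
  shows "seq_adj A \<in> FY Y" and "seqnorm (seq_adj A) \<le> seqnorm A"
proof -
  have *: "opnorm (seq_adj A n) \<le> seqnorm A" for n
    using opnorm_adj_le[of "A n"] opnorm_le_seqnorm[OF assms, of n] assms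
    by (simp add: seq_adj_def)
  have eq: "P_op (Y n) \<circ> op_adj (A n) \<circ> P_op (Y n) = op_adj (A n)" for n
  proof -
    have "P_op (Y n) \<circ> A n \<circ> P_op (Y n) = A n" using assms unfolding FY_def by blast
    then have "op_adj (A n) = op_adj (P_op (Y n) \<circ> A n \<circ> P_op (Y n))" by (rule arg_cong[symmetric])
    also have "\<dots> = P_op (Y n) \<circ> op_adj (A n) \<circ> P_op (Y n)"
      using FY_bounded[OF assms, of n] by (simp add: op_adj_comp op_adj_P_op comp_assoc)
    finally show ?thesis by simp
  qed
  show "seq_adj A \<in> FY Y"
    unfolding FY_def using assms *
    by (auto simp: seq_adj_def eq intro!: bdd_aboveI[of _ "seqnorm A"])
  show "seqnorm (seq_adj A) \<le> seqnorm A" by (rule seqnorm_leI[OF *])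
qed

section \<open>Closed sets and closures in the algebra of bounded sequences\<close>

lemma cstar_subalg_FY: "cstar_subalg Y (FY Y)"
  by (simp add: cstar_subalg_def FY_add FY_mult FY_scale FY_adj)

lemma seq_closed_FY: "seq_closed Y (FY Y)"
  by (simp add: seq_closed_def)

text \<open>Passes from sequential closedness to \<epsilon>-approximation: approximants with error
  at most 1/(k+1) form a convergent sequence.\<close>

lemma seq_closed_approx:
  assumes "seq_closed Y C" "C \<subseteq> FY Y" "B \<in> FY Y"
    and "\<And>\<epsilon>. \<epsilon> > 0 \<Longrightarrow> \<exists>X\<in>C. seqnorm (seq_diff X B) \<le> \<epsilon>"
  shows "B \<in> C"
proof -
  have "\<forall>k. \<exists>X\<in>C. seqnorm (seq_diff X B) \<le> inverse (real (Suc k))"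
    by (intro allI assms(4)) simp
  then obtain f where f: "\<And>k. f k \<in> C" "\<And>k. seqnorm (seq_diff (f k) B) \<le> inverse (real (Suc k))"
    by metis
  have "(\<lambda>k. seqnorm (seq_diff (f k) B)) \<longlonglongrightarrow> 0"
  proof (rule tendsto_sandwich[OF _ _ tendsto_const LIMSEQ_inverse_real_of_nat]; intro always_eventually allI)
    show "0 \<le> seqnorm (seq_diff (f k) B)" for k
      using f(1) assms(2,3) by (intro seqnorm_nonneg[where Y = Y] FY_diff) auto
    show "seqnorm (seq_diff (f k) B) \<le> inverse (real (Suc k))" for k by (rule f(2))
  qed
  then show ?thesis using assms(1,3) f(1) unfolding seq_closed_def by blast
qed

lemma seq_closedD:
  "seq_closed Y C \<Longrightarrow> (\<And>k. f k \<in> C) \<Longrightarrow> B \<in> FY Y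
    \<Longrightarrow> (\<lambda>k. seqnorm (seq_diff (f k) B)) \<longlonglongrightarrow> 0 \<Longrightarrow> B \<in> C"
  unfolding seq_closed_def by blast

lemma seq_closedE:
  assumes "(\<lambda>k. seqnorm (seq_diff (f k) B)) \<longlonglongrightarrow> 0" "\<epsilon> > 0"
  obtains k where "seqnorm (seq_diff (f k) B) < \<epsilon>"
  using eventually_happens'[OF _ order_tendstoD(2)[OF assms]] that by auto

text \<open>This is the norm closure inside \<open>FY\<close>. Describing it by approximation lets
  each algebraic operation be checked for one \<epsilon> at a time.\<close>

definition seq_closure :: "(nat \<Rightarrow> 'a set) \<Rightarrow> 'a opseq set \<Rightarrow> 'a opseq set" where
  "seq_closure Y M = {A \<in> FY Y. \<forall>\<epsilon>>0. \<exists>X\<in>M. seqnorm (seq_diff X A) \<le> \<epsilon>}"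

lemma seq_closureD:
  assumes "A \<in> seq_closure Y M" "\<epsilon> > 0"
  obtains X where "X \<in> M" "seqnorm (seq_diff X A) \<le> \<epsilon>"
proof -
  have "\<exists>X\<in>M. seqnorm (seq_diff X A) \<le> \<epsilon>" using assms by (simp add: seq_closure_def)
  then show ?thesis using that by blast
qed

lemma seq_closed_seq_closure:
  assumes "M \<subseteq> FY Y"
  shows "seq_closed Y (seq_closure Y M)"
  unfolding seq_closed_def
proof (intro allI impI, elim conjE)
  fix f B
  assume f: "\<forall>k. f k \<in> seq_closure Y M" and B: "B \<in> FY Y"
    and lim: "(\<lambda>k. seqnorm (seq_diff (f k) B)) \<longlonglongrightarrow> 0"
  have "\<exists>X\<in>M. seqnorm (seq_diff X B) \<le> \<epsilon>" if "\<epsilon> > 0" for \<epsilon>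
  proof -
    obtain k where k: "seqnorm (seq_diff (f k) B) < \<epsilon> / 2"
      using seq_closedE[OF lim, of "\<epsilon> / 2"] \<open>\<epsilon> > 0\<close> by auto
    obtain X where X: "X \<in> M" "seqnorm (seq_diff X (f k)) \<le> \<epsilon> / 2"
      using seq_closureD[of "f k" Y M "\<epsilon> / 2"] f \<open>\<epsilon> > 0\<close> by auto
    have "seqnorm (seq_diff X B) \<le> seqnorm (seq_diff X (f k)) + seqnorm (seq_diff (f k) B)"
      using X f B assms by (intro seqnorm_diff_triangle) (auto simp: seq_closure_def)
    then show ?thesis using X k by (intro bexI[of _ X]) auto
  qed
  then show "B \<in> seq_closure Y M" using B by (simp add: seq_closure_def)
qed

text \<open>All four operations are norm continuous; only the product needs a bound on one of the
  approximants.\<close>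

lemma cstar_subalg_seq_closure:
  assumes M: "cstar_subalg Y M"
  shows "cstar_subalg Y (seq_closure Y M)"
proof -
  have MF: "\<And>X. X \<in> M \<Longrightarrow> X \<in> FY Y" using M by (auto simp: cstar_subalg_def)
  have CF: "\<And>A. A \<in> seq_closure Y M \<Longrightarrow> A \<in> FY Y" by (simp add: seq_closure_def)
  have add: "seq_add A B \<in> seq_closure Y M" and mult: "seq_mult A B \<in> seq_closure Y M"
    if A: "A \<in> seq_closure Y M" and B: "B \<in> seq_closure Y M" for A B
  proof -
    note F = CF[OF A] CF[OF B]
    have "\<exists>X\<in>M. seqnorm (seq_diff X (seq_add A B)) \<le> \<epsilon>" if "\<epsilon> > 0" for \<epsilon>
    proof -
      obtain X where X: "X \<in> M" "seqnorm (seq_diff X A) \<le> \<epsilon> / 2"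
        by (rule seq_closureD[OF A half_gt_zero[OF \<open>\<epsilon> > 0\<close>]])
      obtain Z where Z: "Z \<in> M" "seqnorm (seq_diff Z B) \<le> \<epsilon> / 2"
        by (rule seq_closureD[OF B half_gt_zero[OF \<open>\<epsilon> > 0\<close>]])
      have "seq_diff (seq_add X Z) (seq_add A B) = seq_add (seq_diff X A) (seq_diff Z B)"
        by (simp add: seq_diff_def seq_add_def op_diff_def op_add_def algebra_simps)
      then have "seqnorm (seq_diff (seq_add X Z) (seq_add A B)) \<le> \<epsilon>"
        using FY_add(2)[of "seq_diff X A" Y "seq_diff Z B"] F MF[OF X(1)] MF[OF Z(1)] X Z by simp
      then show ?thesis using X Z M by (auto simp: cstar_subalg_def)
    qed
    then show "seq_add A B \<in> seq_closure Y M"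
      using F by (simp add: seq_closure_def FY_add)
    have "\<exists>X\<in>M. seqnorm (seq_diff X (seq_mult A B)) \<le> \<epsilon>" if "\<epsilon> > 0" for \<epsilon>
    proof -
      \<comment> \<open>With XZ - AB = X(Z - B) + (X - A)B and errors at most \<delta>, the total is
        at most \<delta>(seqnorm X + seqnorm B). The condition \<delta> \<le> 1 gives seqnorm X
        \<le> seqnorm A + 1, so the total is at most \<delta> K, whence the choice \<delta> \<le>
        \<epsilon> / K.\<close>
      define K where "K = seqnorm A + seqnorm B + 1"
      have K: "K > 0" using F by (simp add: K_def add_nonneg_pos)
      define \<delta> where "\<delta> = min 1 (\<epsilon> / K)"
      have \<delta>: "\<delta> > 0" "\<delta> \<le> 1" "\<delta> \<le> \<epsilon> / K" using K \<open>\<epsilon> > 0\<close> by (auto simp: \<delta>_def)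
      obtain X where X: "X \<in> M" "seqnorm (seq_diff X A) \<le> \<delta>"
        by (rule seq_closureD[OF A \<delta>(1)])
      obtain Z where Z: "Z \<in> M" "seqnorm (seq_diff Z B) \<le> \<delta>"
        by (rule seq_closureD[OF B \<delta>(1)])
      note G = MF[OF X(1)] MF[OF Z(1)]
      have Xn: "seqnorm X \<le> seqnorm A + 1"
        using seqnorm_le_diff[OF G(1) F(1)] X(2) \<delta> by linarith
      have eq: "seq_diff (seq_mult X Z) (seq_mult A B)
          = seq_add (seq_mult X (seq_diff Z B)) (seq_mult (seq_diff X A) B)"
      proof
        fix n
        show "seq_diff (seq_mult X Z) (seq_mult A B) n
          = seq_add (seq_mult X (seq_diff Z B)) (seq_mult (seq_diff X A) B) n"
          unfolding seq_diff_def seq_mult_def seq_add_def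
          by (rule bounded_op_eqI; (use F G in \<open>simp; fail\<close>)?; use F G in \<open>simp add: op_diff_def op_add_def bounded_op_diff\<close>)
      qed
      have "seqnorm (seq_diff (seq_mult X Z) (seq_mult A B))
          \<le> seqnorm (seq_mult X (seq_diff Z B)) + seqnorm (seq_mult (seq_diff X A) B)"
        unfolding eq using F G by (intro FY_add FY_mult FY_diff)
      also have "\<dots> \<le> seqnorm X * seqnorm (seq_diff Z B) + seqnorm (seq_diff X A) * seqnorm B"
        using F G by (intro add_mono FY_mult FY_diff)
      also have "\<dots> \<le> (seqnorm A + 1) * \<delta> + \<delta> * seqnorm B"
        using F X Z Xn \<delta>(1) seqnorm_nonneg[OF FY_diff[OF G(2) F(2)]]
        by (intro add_mono mult_mono) auto
      also have "\<dots> = K * \<delta>" by (simp add: K_def algebra_simps)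
      also have "\<dots> \<le> \<epsilon>" using \<delta>(3) K by (simp add: field_simps)
      finally show ?thesis using X Z M by (auto simp: cstar_subalg_def)
    qed
    then show "seq_mult A B \<in> seq_closure Y M"
      using F by (simp add: seq_closure_def FY_mult)
  qed
  have scale: "seq_scale c A \<in> seq_closure Y M" if A: "A \<in> seq_closure Y M" for A c
  proof -
    note F = CF[OF A]
    have "\<exists>X\<in>M. seqnorm (seq_diff X (seq_scale c A)) \<le> \<epsilon>" if "\<epsilon> > 0" for \<epsilon>
    proof -
      \<comment> \<open>The summand 1 keeps the tolerance meaningful when
        \<open>c = 0\<close>.\<close>
      have c: "cmod c + 1 > 0" by (simp add: add_nonneg_pos)
      obtain X where X: "X \<in> M" "seqnorm (seq_diff X A) \<le> \<epsilon> / (cmod c + 1)"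
        using seq_closureD[OF A, of "\<epsilon> / (cmod c + 1)"] \<open>\<epsilon> > 0\<close> c by auto
      have eq: "seq_diff (seq_scale c X) (seq_scale c A) = seq_scale c (seq_diff X A)"
        by (simp add: seq_diff_def seq_scale_def op_diff_def op_scale_def algebra_simps)
      have "seqnorm (seq_scale c (seq_diff X A)) \<le> cmod c * seqnorm (seq_diff X A)"
        using F MF[OF X(1)] by (intro FY_scale FY_diff)
      also have "\<dots> \<le> (cmod c + 1) * (\<epsilon> / (cmod c + 1))"
        using X c seqnorm_nonneg[OF FY_diff[OF MF[OF X(1)] F]] by (intro mult_mono) auto
      also have "\<dots> = \<epsilon>" using c by simp
      finally show ?thesis using X M eq by (metis cstar_subalg_def)
    qed
    then show ?thesis using F by (simp add: seq_closure_def FY_scale)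
  qed
  have adj: "seq_adj A \<in> seq_closure Y M" if A: "A \<in> seq_closure Y M" for A
  proof -
    note F = CF[OF A]
    have "\<exists>X\<in>M. seqnorm (seq_diff X (seq_adj A)) \<le> \<epsilon>" if "\<epsilon> > 0" for \<epsilon>
    proof -
      obtain X where X: "X \<in> M" "seqnorm (seq_diff X A) \<le> \<epsilon>"
        using seq_closureD[OF A \<open>\<epsilon> > 0\<close>] by auto
      have "seq_diff (seq_adj X) (seq_adj A) = seq_adj (seq_diff X A)"
        using F MF[OF X(1)] by (simp add: seq_diff_def seq_adj_def op_adj_diff)
      then have "seqnorm (seq_diff (seq_adj X) (seq_adj A)) \<le> \<epsilon>"
        using FY_adj(2)[of "seq_diff X A" Y] F MF[OF X(1)] X by simp
      then show ?thesis using X M by (auto simp: cstar_subalg_def)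
    qed
    then show ?thesis using F by (simp add: seq_closure_def FY_adj)
  qed
  show ?thesis
    using add mult scale adj CF by (auto simp: cstar_subalg_def)
qed

section \<open>Compressions and Hankel sequences\<close>

text \<open>This is D(B) of the overview, the sequence of finite sections of
  \<open>B\<close>.\<close>

definition compress :: "(nat \<Rightarrow> 'a set) \<Rightarrow> 'a op \<Rightarrow> 'a opseq" where
  "compress Y B = (\<lambda>n. P_op (Y n) \<circ> B \<circ> P_op (Y n))"

text \<open>This is H(B,C) of the overview. The sequence belonging to \<omega> in the theorem is the
  case \<open>B = shift_op (- \<omega>)\<close>, \<open>C = shift_op \<omega>\<close>.\<close>

definition hankel :: "(nat \<Rightarrow> 'a set) \<Rightarrow> 'a op \<Rightarrow> 'a op \<Rightarrow> 'a opseq" where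
  "hankel Y B C = (\<lambda>n. P_op (Y n) \<circ> B \<circ> Q_op (Y n) \<circ> C \<circ> P_op (Y n))"

definition zero_seq :: "'a opseq" where
  "zero_seq = (\<lambda>n u t. 0)"

lemma compress_FY:
  assumes "bounded_op B"
  shows "compress Y B \<in> FY Y" and "seqnorm (compress Y B) \<le> opnorm B"
proof -
  have *: "opnorm (compress Y B n) \<le> opnorm B" for n
  proof (rule opnorm_leI)
    fix u :: "'a \<Rightarrow> complex" assume u: "u \<in> l2"
    have "l2norm (P_op (Y n) (B (P_op (Y n) u))) \<le> l2norm (B (P_op (Y n) u))"
      using assms by (intro l2norm_P_op) simp
    also have "\<dots> \<le> opnorm B * l2norm (P_op (Y n) u)"
      using assms by (intro opnorm_bound) simp_all
    also have "\<dots> \<le> opnorm B * l2norm u"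
      using assms u by (intro mult_left_mono l2norm_P_op) simp_all
    finally show "l2norm (compress Y B n u) \<le> opnorm B * l2norm u"
      by (simp add: compress_def)
  qed (use assms in simp)
  show "compress Y B \<in> FY Y"
    by (rule FYI[OF _ _ _ *]) (use assms in \<open>simp_all add: compress_def\<close>)
  show "seqnorm (compress Y B) \<le> opnorm B" by (rule seqnorm_leI[OF *])
qed

lemma hankel_FY:
  assumes "bounded_op B" "bounded_op C"
  shows "hankel Y B C \<in> FY Y" and "seqnorm (hankel Y B C) \<le> opnorm B * opnorm C"
proof -
  have *: "opnorm (hankel Y B C n) \<le> opnorm B * opnorm C" for n
  proof (rule opnorm_leI)
    fix u :: "'a \<Rightarrow> complex" assume u: "u \<in> l2"
    have "l2norm (P_op (Y n) (B (Q_op (Y n) (C (P_op (Y n) u))))) \<le> l2norm (B (Q_op (Y n) (C (P_op (Y n) u))))"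
      using assms by (intro l2norm_P_op) simp
    also have "\<dots> \<le> opnorm B * l2norm (Q_op (Y n) (C (P_op (Y n) u)))"
      using assms by (intro opnorm_bound) simp_all
    also have "\<dots> \<le> opnorm B * l2norm (C (P_op (Y n) u))"
      using assms u by (intro mult_left_mono l2norm_Q_op) simp_all
    also have "\<dots> \<le> opnorm B * (opnorm C * l2norm (P_op (Y n) u))"
      using assms by (intro mult_left_mono opnorm_bound) simp_all
    also have "\<dots> \<le> opnorm B * (opnorm C * l2norm u)"
      using assms u by (intro mult_left_mono l2norm_P_op) simp_all
    finally show "l2norm (hankel Y B C n u) \<le> opnorm B * opnorm C * l2norm u"
      by (simp add: hankel_def mult.assoc)
  qed (use assms in simp)
  show "hankel Y B C \<in> FY Y"
    by (rule FYI[OF _ _ _ *]) (use assms in \<open>simp_all add: hankel_def\<close>)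
  show "seqnorm (hankel Y B C) \<le> opnorm B * opnorm C" by (rule seqnorm_leI[OF *])
qed

text \<open>Writing the middle projection as I - Q identifies the Hankel sequence as the defect of
  multiplicativity of \<open>compress\<close>.\<close>

lemma compress_mult:
  assumes "bounded_op B" "bounded_op C"
  shows "seq_mult (compress Y B) (compress Y C)
    = seq_diff (compress Y (B \<circ> C)) (hankel Y B C)"
proof
  fix n
  show "seq_mult (compress Y B) (compress Y C) n = seq_diff (compress Y (B \<circ> C)) (hankel Y B C) n"
    unfolding seq_mult_def seq_diff_def compress_def hankel_def
    by (rule bounded_op_eqI; (use assms in \<open>simp; fail\<close>)?;
        use assms in \<open>simp add: op_diff_def Q_op_apply bounded_op_diff\<close>)
qed

lemma hankel_conv:
  assumes "bounded_op B" "bounded_op C"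
  shows "hankel Y B C = seq_diff (compress Y (B \<circ> C)) (seq_mult (compress Y B) (compress Y C))"
  by (simp add: compress_mult[OF assms], simp add: seq_diff_def op_diff_def)

text \<open>The right-hand side is PBQCPC'P + PBCQC'P - PBPCQC'P. Its last two terms merge to
  PBQCQC'P, and P + Q = I finishes. One term has left symbol BC, so an induction on the right symbol
  must cover all left symbols at once.\<close>

lemma hankel_comp:
  assumes "bounded_op B" "bounded_op C" "bounded_op C'"
  shows "hankel Y B (C \<circ> C') = seq_diff
    (seq_add (seq_mult (hankel Y B C) (compress Y C')) (hankel Y (B \<circ> C) C'))
    (seq_mult (compress Y B) (hankel Y C C'))"
proof
  fix n
  show "hankel Y B (C \<circ> C') n = seq_diff
    (seq_add (seq_mult (hankel Y B C) (compress Y C')) (hankel Y (B \<circ> C) C'))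
    (seq_mult (compress Y B) (hankel Y C C')) n"
    unfolding seq_mult_def seq_diff_def seq_add_def compress_def hankel_def
    by (rule bounded_op_eqI; (use assms in \<open>simp; fail\<close>)?;
        use assms in \<open>simp add: op_diff_def op_add_def Q_op_apply bounded_op_diff l2_diff\<close>)
qed

lemma hankel_add:
  assumes "bounded_op B" "bounded_op C" "bounded_op C'"
  shows "hankel Y B (op_add C C') = seq_add (hankel Y B C) (hankel Y B C')"
proof
  fix n
  show "hankel Y B (op_add C C') n = seq_add (hankel Y B C) (hankel Y B C') n"
    unfolding seq_add_def hankel_def
    by (rule bounded_op_eqI; (use assms in \<open>simp; fail\<close>)?;
        use assms in \<open>simp add: op_add_def bounded_op_add\<close>)
qed

lemma hankel_scale:
  assumes "bounded_op B" "bounded_op C"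
  shows "hankel Y B (op_scale c C) = seq_scale c (hankel Y B C)"
proof
  fix n
  show "hankel Y B (op_scale c C) n = seq_scale c (hankel Y B C) n"
    unfolding seq_scale_def hankel_def
    by (rule bounded_op_eqI; (use assms in \<open>simp; fail\<close>)?;
        use assms in \<open>simp add: op_scale_def bounded_op_scale\<close>)
qed

lemma hankel_diff:
  assumes "bounded_op B" "bounded_op C" "bounded_op C'"
  shows "hankel Y B (op_diff C C') = seq_diff (hankel Y B C) (hankel Y B C')"
  using assms by (simp add: op_diff_conv seq_diff_conv hankel_add hankel_scale)

lemma Q_op_value: "u \<in> l2 \<Longrightarrow> Q_op X u t = (if t \<in> X then 0 else u t)"
  by (simp add: Q_op_apply P_op_def)

text \<open>Multiplication does not enlarge supports, so the part mapped out of \<open>Y n\<close>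
  vanishes.\<close>

lemma hankel_mult_op:
  assumes "bounded_op B" "a \<in> linfty"
  shows "hankel Y B (mult_op a) = zero_seq"
proof -
  have "Q_op X (mult_op a (P_op X u)) = (\<lambda>_. 0)" for X u
  proof
    fix t
    have "mult_op a (P_op X u) t = a t * P_op X u t" by (simp add: mult_op_def)
    moreover have "t \<notin> X \<Longrightarrow> P_op X u t = 0" by (simp add: P_op_def)
    ultimately show "Q_op X (mult_op a (P_op X u)) t = 0"
      using assms(2) by (simp add: Q_op_value)
  qed
  then show ?thesis
    using assms by (intro ext) (simp add: hankel_def zero_seq_def)
qed

text \<open>\<open>Q L\<^sub>\<omega> P\<close> is a partial isometry, so a Hankel sequence with right symbol \<open>L\<^sub>\<omega>\<close> factors through
  the generator belonging to \<open>\<omega>\<close>.\<close>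

lemma hankel_shift:
  assumes "bounded_op B"
  shows "hankel Y B (shift_op \<omega>) = seq_mult (hankel Y B (shift_op \<omega>)) (hankel Y (shift_op (- \<omega>)) (shift_op \<omega>))"
proof (intro ext)
  fix n u t
  let ?P = "P_op (Y n)" and ?Q = "Q_op (Y n)" and ?L = "shift_op \<omega>" and ?M = "shift_op (- \<omega>)"
  have P: "v \<in> l2 \<Longrightarrow> ?P v s = (if s \<in> Y n then v s else 0)" for v s by (simp add: P_op_def)
  have L: "v \<in> l2 \<Longrightarrow> ?L v s = v (- \<omega> + s)" for v s by (simp add: shift_op_def)
  have M: "v \<in> l2 \<Longrightarrow> ?M v s = v (\<omega> + s)" for v s by (simp add: shift_op_def)
  define w where "w = ?P u"
  have w: "w \<in> l2" "\<And>s. s \<notin> Y n \<Longrightarrow> w s = 0" by (simp_all add: w_def) (simp add: P_op_def)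
  \<comment> \<open>Checked pointwise: the value of \<open>?Q (?L w)\<close> at a point s outside
    \<open>Y n\<close> is w(-\<omega> + s). It is moved back to -\<omega> + s, where
    \<open>?P\<close> keeps it since \<open>w\<close> vanishes off \<open>Y n\<close>, and is then
    returned to s, where \<open>?Q\<close> keeps it.\<close>
  have "?Q (?L (?P (?M (?Q (?L w))))) = ?Q (?L w)"
    using w by (intro ext) (simp add: P L M Q_op_value add.assoc[symmetric])
  then show "hankel Y B ?L n u t = seq_mult (hankel Y B ?L) (hankel Y ?M ?L) n u t"
    by (simp add: hankel_def seq_mult_def w_def)
qed

section \<open>Adjoints of sequences\<close>

lemma op_adj_zero: "op_adj (\<lambda>u t. 0) = (\<lambda>u t. 0)"
  by (rule op_adjI) (auto intro!: bounded_opI[where C = 0] simp: l2inner_def)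

lemma seq_adj_zero: "seq_adj zero_seq = zero_seq"
  by (simp add: seq_adj_def zero_seq_def op_adj_zero)

lemma seq_adj_adj: "A \<in> FY Y \<Longrightarrow> seq_adj (seq_adj A) = A"
  by (simp add: seq_adj_def op_adj_op_adj)

lemma seq_adj_add: "A \<in> FY Y \<Longrightarrow> B \<in> FY Y \<Longrightarrow> seq_adj (seq_add A B) = seq_add (seq_adj A) (seq_adj B)"
  by (simp add: seq_adj_def seq_add_def op_adj_add)

lemma seq_adj_scale: "A \<in> FY Y \<Longrightarrow> seq_adj (seq_scale c A) = seq_scale (cnj c) (seq_adj A)"
  by (simp add: seq_adj_def seq_scale_def op_adj_scale)

lemma seq_adj_mult: "A \<in> FY Y \<Longrightarrow> B \<in> FY Y \<Longrightarrow> seq_adj (seq_mult A B) = seq_mult (seq_adj B) (seq_adj A)"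
  by (simp add: seq_adj_def seq_mult_def op_adj_comp)

lemma seq_adj_compress: "bounded_op B \<Longrightarrow> seq_adj (compress Y B) = compress Y (op_adj B)"
  by (simp add: seq_adj_def compress_def op_adj_comp op_adj_P_op comp_assoc)

lemma seq_adj_hankel:
  "bounded_op B \<Longrightarrow> bounded_op C \<Longrightarrow> seq_adj (hankel Y B C) = hankel Y (op_adj C) (op_adj B)"
  by (simp add: seq_adj_def hankel_def op_adj_comp op_adj_P_op op_adj_Q_op comp_assoc)

section \<open>The algebra generated by the finite sections\<close>

lemma SY_subset:
  assumes "cstar_subalg Y C" "seq_closed Y C" "\<And>A. A \<in> BDO \<Longrightarrow> compress Y A \<in> C"
  shows "SY Y \<subseteq> C"
  using assms unfolding SY_def compress_def by blast

lemma SY_FY: "A \<in> SY Y \<Longrightarrow> A \<in> FY Y"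
  using SY_subset[OF cstar_subalg_FY seq_closed_FY] compress_FY(1) BDO_bounded by blast

lemma SY_add: "A \<in> SY Y \<Longrightarrow> B \<in> SY Y \<Longrightarrow> seq_add A B \<in> SY Y"
  and SY_mult: "A \<in> SY Y \<Longrightarrow> B \<in> SY Y \<Longrightarrow> seq_mult A B \<in> SY Y"
  and SY_scale: "A \<in> SY Y \<Longrightarrow> seq_scale c A \<in> SY Y"
  and SY_adj: "A \<in> SY Y \<Longrightarrow> seq_adj A \<in> SY Y"
  unfolding SY_def cstar_subalg_def by blast+

lemma SY_compress: "A \<in> BDO \<Longrightarrow> compress Y A \<in> SY Y"
  unfolding SY_def compress_def by blast

lemma SY_closed: "seq_closed Y (SY Y)"
  unfolding seq_closed_def
proof (intro allI impI, elim conjE)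
  fix f B assume *: "\<forall>k. f k \<in> SY Y" "B \<in> FY Y" "(\<lambda>k. seqnorm (seq_diff (f k) B)) \<longlonglongrightarrow> 0"
  show "B \<in> SY Y"
    unfolding SY_def
  proof (rule InterI)
    fix C assume C: "C \<in> {C. cstar_subalg Y C \<and> seq_closed Y C \<and>
      (\<forall>A\<in>BDO. (\<lambda>n. P_op (Y n) \<circ> A \<circ> P_op (Y n)) \<in> C)}"
    then have "\<forall>k. f k \<in> C" using *(1) unfolding SY_def by blast
    then show "B \<in> C" using C * unfolding seq_closed_def by blast
  qed
qed

lemma SY_diff: "A \<in> SY Y \<Longrightarrow> B \<in> SY Y \<Longrightarrow> seq_diff A B \<in> SY Y"
  by (simp add: seq_diff_conv SY_add SY_scale)

lemma SY_hankel: "B \<in> BDO \<Longrightarrow> C \<in> BDO \<Longrightarrow> hankel Y B C \<in> SY Y"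
  by (simp add: hankel_conv SY_diff SY_mult SY_compress)

lemma shift_op_add: "shift_op (r + s) = shift_op r \<circ> shift_op s"
proof (rule bounded_op_eqI)
  fix u :: "'a \<Rightarrow> complex" and t assume u: "u \<in> l2"
  have "shift_op s u \<in> l2" by simp
  then show "shift_op (r + s) u t = (shift_op r \<circ> shift_op s) u t"
    using u by (simp add: shift_op_def minus_add add.assoc del: add_uminus_conv_diff)
qed simp_all

text \<open>Viewing the identity as a multiplication operator lets the empty product of generators
  be settled by the multiplication case.\<close>

lemma shift_op_zero: "shift_op 0 = mult_op (\<lambda>_. 1)"
  by (simp add: shift_op_def mult_op_def fun_eq_iff)

section \<open>Closed ideals and the Hankel sequences they contain\<close>

text \<open>The empty set satisfies \<open>closed_ideal\<close>, so \<open>zero_seq\<close> is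
  obtained from a given member, multiplied by 0.\<close>

lemma closed_idealD:
  assumes "closed_ideal Y S I"
  shows "I \<subseteq> S" and "A \<in> I \<Longrightarrow> B \<in> I \<Longrightarrow> seq_add A B \<in> I" and "A \<in> I \<Longrightarrow> seq_scale c A \<in> I"
    and "A \<in> I \<Longrightarrow> B \<in> S \<Longrightarrow> seq_mult A B \<in> I" and "A \<in> I \<Longrightarrow> B \<in> S \<Longrightarrow> seq_mult B A \<in> I"
    and "A \<in> I \<Longrightarrow> B \<in> I \<Longrightarrow> seq_diff A B \<in> I" and "seq_closed Y I"
    and "A \<in> I \<Longrightarrow> zero_seq \<in> I"
proof -
  have "zero_seq = seq_scale 0 A" by (simp add: zero_seq_def seq_scale_def op_scale_def)
  then show "A \<in> I \<Longrightarrow> zero_seq \<in> I" using assms unfolding closed_ideal_def by metis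
qed (use assms in \<open>simp_all add: closed_ideal_def seq_diff_conv\<close>)

text \<open>Induction over \<open>BDO\<close> in the right symbol, with the left symbol universally
  quantified inside \<open>T\<close>, as \<open>hankel_comp\<close> demands.\<close>

lemma closed_ideal_contains_hankel:
  fixes \<Omega> :: "'a::group_add set"
  assumes gen: "generates_semigroup \<Omega>" and I: "closed_ideal Y (SY Y) I"
    and \<Omega>: "\<And>\<omega>. \<omega> \<in> \<Omega> \<Longrightarrow> hankel Y (shift_op (- \<omega>)) (shift_op \<omega>) \<in> I"
    and BC: "B \<in> BDO" "C \<in> BDO"
  shows "hankel Y B C \<in> I"
proof -
  define T where "T = {C \<in> BDO. \<forall>B\<in>BDO. hankel Y B C \<in> I}"
  \<comment> \<open>Every group element is the sum of a nonempty list over \<Omega>, so there is at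
    least one generator, and \<open>I\<close> is inhabited.\<close>
  have "\<exists>\<omega>. \<omega> \<in> \<Omega>"
    using gen unfolding generates_semigroup_def
    by (metis (no_types) all_not_in_conv set_empty2 subset_empty)
  then have zero: "zero_seq \<in> I" using \<Omega> closed_idealD(8)[OF I] by blast
  have comp: "C \<circ> C' \<in> T" if "C \<in> T" "C' \<in> T" for C C'
  proof -
    have C: "C \<in> BDO" "C' \<in> BDO" using that by (simp_all add: T_def)
    have "hankel Y B (C \<circ> C') \<in> I" if B: "B \<in> BDO" for B
    proof -
      have "hankel Y B C \<in> I" "hankel Y (B \<circ> C) C' \<in> I" "hankel Y C C' \<in> I"
        using \<open>C \<in> T\<close> \<open>C' \<in> T\<close> B by (simp_all add: T_def)
      then show ?thesis
        unfolding hankel_comp[OF BDO_bounded[OF B] BDO_bounded[OF C(1)] BDO_bounded[OF C(2)]]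
        using B C
        by (intro closed_idealD(2)[OF I] closed_idealD(6)[OF I] closed_idealD(4)[OF I, of "hankel Y B C"]
            closed_idealD(5)[OF I, of "hankel Y C C'"] SY_compress)
    qed
    then show ?thesis using C by (simp add: T_def)
  qed
  have mult: "mult_op a \<in> T" if "a \<in> linfty" for a
    using that zero by (simp add: T_def hankel_mult_op)
  have one: "(\<lambda>_. 1) \<in> linfty" by (auto simp: linfty_def)
  have shift_gen: "shift_op \<omega> \<in> T" if "\<omega> \<in> \<Omega>" for \<omega>
  proof -
    \<comment> \<open>By the factorization \<open>hankel_shift\<close>, the sequence is a member of
      \<open>SY Y\<close> times the generator of \<open>I\<close> belonging to \<omega>.\<close>
    have "hankel Y B (shift_op \<omega>) \<in> I" if "B \<in> BDO" for B
      using that \<open>\<omega> \<in> \<Omega>\<close> \<Omega> BDO_bounded[OF that]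
      by (subst hankel_shift) (auto intro!: closed_idealD(5)[OF I] SY_hankel)
    then show ?thesis by (simp add: T_def)
  qed
  \<comment> \<open>Semigroup generation reaches every shift by products of the
    \<open>shift_op \<omega>\<close> with \<omega> \<in> \<Omega> alone; inverses never have to be
    treated separately.\<close>
  have shift_list: "set xs \<subseteq> \<Omega> \<Longrightarrow> shift_op (sum_list xs) \<in> T" for xs
    by (induction xs) (auto simp: shift_op_zero shift_op_add mult[OF one] shift_gen comp)
  have shift: "shift_op g \<in> T" for g
    using gen shift_list unfolding generates_semigroup_def by metis
  have closed: "op_closed T"
    unfolding op_closed_def
  proof (intro allI impI, elim conjE)
    fix f C
    assume f: "\<forall>k. f k \<in> T" and C: "bounded_op C" and lim: "(\<lambda>k. opnorm (op_diff (f k) C)) \<longlonglongrightarrow> 0"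
    have fb: "f k \<in> BDO" for k using f by (simp add: T_def)
    have "hankel Y B C \<in> I" if B: "B \<in> BDO" for B
    proof -
      have "(\<lambda>k. seqnorm (seq_diff (hankel Y B (f k)) (hankel Y B C))) \<longlonglongrightarrow> 0"
      proof (rule tendsto_sandwich[OF _ _ tendsto_const tendsto_mult_right_zero[OF lim, of "opnorm B"]];
          intro always_eventually allI)
        fix k
        have eq: "seq_diff (hankel Y B (f k)) (hankel Y B C) = hankel Y B (op_diff (f k) C)"
          using B C fb[of k] by (simp add: hankel_diff)
        have b: "bounded_op B" "bounded_op (op_diff (f k) C)" using B C fb[of k] by simp_all
        show "0 \<le> seqnorm (seq_diff (hankel Y B (f k)) (hankel Y B C))"
          unfolding eq by (rule seqnorm_nonneg[OF hankel_FY(1)[OF b]])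
        show "seqnorm (seq_diff (hankel Y B (f k)) (hankel Y B C)) \<le> opnorm B * opnorm (op_diff (f k) C)"
          unfolding eq by (rule hankel_FY(2)[OF b])
      qed
      moreover have "\<forall>k. hankel Y B (f k) \<in> I" using f B by (simp add: T_def)
      moreover have "hankel Y B C \<in> FY Y" using B C by (intro hankel_FY) simp_all
      ultimately show ?thesis
        using seq_closedD[OF closed_idealD(7)[OF I], of "\<lambda>k. hankel Y B (f k)"] by simp
    qed
    then show "C \<in> T" using BDO_closed[OF fb C lim] by (simp add: T_def)
  qed
  have "op_subalg T"
    using comp
    by (auto simp: op_subalg_def T_def hankel_add hankel_scale intro!: closed_idealD(2)[OF I] closed_idealD(3)[OF I])
  then have "BDO \<subseteq> T" using closed shift mult by (rule BDO_subset)
  then show ?thesis using BC by (auto simp: T_def)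
qed

section \<open>Strong convergence\<close>

text \<open>The trailing projection in the definition of \<open>JY\<close> is absent because
  sequences in \<open>FY\<close> absorb it; see \<open>JY_iff\<close>.\<close>

definition strongly_null :: "'a opseq \<Rightarrow> bool" where
  "strongly_null A \<longleftrightarrow> (\<forall>u\<in>l2. (\<lambda>n. l2norm (A n u)) \<longlonglongrightarrow> 0)"

text \<open>The limit is recorded vector by vector, so no boundedness or linearity of a limit
  operator has to be established.\<close>

definition strongly_convergent :: "'a opseq \<Rightarrow> bool" where
  "strongly_convergent A \<longleftrightarrow> (\<forall>u\<in>l2. \<exists>w\<in>l2. (\<lambda>n. l2norm (\<lambda>t. A n u t - w t)) \<longlonglongrightarrow> 0)"

lemma tendsto_zero_upper:
  fixes f g :: "nat \<Rightarrow> real"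
  assumes "g \<longlonglongrightarrow> 0" "\<And>n. 0 \<le> f n" "\<And>n. f n \<le> g n"
  shows "f \<longlonglongrightarrow> 0"
  by (rule tendsto_sandwich[OF _ _ tendsto_const assms(1)]) (use assms in auto)

lemma JY_iff: "A \<in> JY Y \<longleftrightarrow> A \<in> SY Y \<and> strongly_null A"
  using FY_P_right[OF SY_FY[of A Y]]
  by (auto simp: JY_def strong_lim_def strongly_null_def)

lemma strongly_null_zero: "strongly_null zero_seq"
  by (simp add: strongly_null_def zero_seq_def)

lemma strongly_null_add:
  assumes "A \<in> FY Y" "B \<in> FY Y" "strongly_null A" "strongly_null B"
  shows "strongly_null (seq_add A B)"
  unfolding strongly_null_def
proof
  fix u :: "'a \<Rightarrow> complex" assume u: "u \<in> l2"
  have "(\<lambda>n. l2norm (A n u) + l2norm (B n u)) \<longlonglongrightarrow> 0"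
    using assms u by (auto simp: strongly_null_def intro: tendsto_add_zero)
  then show "(\<lambda>n. l2norm (seq_add A B n u)) \<longlonglongrightarrow> 0"
    by (rule tendsto_zero_upper) (use assms in \<open>auto simp: seq_add_def op_add_def intro!: l2_add\<close>)
qed

lemma strongly_null_scale: "strongly_null A \<Longrightarrow> strongly_null (seq_scale c A)"
  by (auto simp: strongly_null_def seq_scale_def op_scale_def l2norm_scale intro: tendsto_mult_right_zero)

lemma strongly_null_mult_left:
  assumes "A \<in> FY Y" "K \<in> FY Y" "strongly_null K"
  shows "strongly_null (seq_mult A K)"
  unfolding strongly_null_def
proof
  fix u :: "'a \<Rightarrow> complex" assume u: "u \<in> l2"
  have "(\<lambda>n. seqnorm A * l2norm (K n u)) \<longlonglongrightarrow> 0"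
    using assms u by (auto simp: strongly_null_def intro: tendsto_mult_right_zero)
  then show "(\<lambda>n. l2norm (seq_mult A K n u)) \<longlonglongrightarrow> 0"
    by (rule tendsto_zero_upper)
       (use assms in \<open>auto simp: seq_mult_def intro!: seqnorm_bound[OF assms(1)]\<close>)
qed

text \<open>If A_n u tends to w, then K_n A_n u = K_n w + K_n(A_n u - w). The first term vanishes in
  the limit since \<open>K\<close> is strongly null, the second since \<open>K\<close> is uniformly
  bounded.\<close>

lemma strongly_null_mult_right:
  assumes K: "K \<in> FY Y" "strongly_null K" and A: "A \<in> FY Y" "strongly_convergent A"
  shows "strongly_null (seq_mult K A)"
  unfolding strongly_null_def
proof
  fix u :: "'a \<Rightarrow> complex" assume u: "u \<in> l2"
  obtain w where w: "w \<in> l2" "(\<lambda>n. l2norm (\<lambda>t. A n u t - w t)) \<longlonglongrightarrow> 0"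
    using A(2) u unfolding strongly_convergent_def by blast
  have "(\<lambda>n. l2norm (K n w) + seqnorm K * l2norm (\<lambda>t. A n u t - w t)) \<longlonglongrightarrow> 0"
    using K(2) w by (auto simp: strongly_null_def intro!: tendsto_add_zero tendsto_mult_right_zero)
  then show "(\<lambda>n. l2norm (seq_mult K A n u)) \<longlonglongrightarrow> 0"
  proof (rule tendsto_zero_upper)
    fix n
    have l: "A n u \<in> l2" "K n (A n u) \<in> l2" "K n w \<in> l2"
      using FY_bounded[OF A(1)] FY_bounded[OF K(1)] by simp_all
    have "l2norm (K n (A n u)) \<le> l2norm (K n w) + l2norm (\<lambda>t. K n (A n u) t - K n w t)"
      by (rule l2norm_triangle_sub[OF l(2,3)])
    also have "(\<lambda>t. K n (A n u) t - K n w t) = K n (\<lambda>t. A n u t - w t)"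
      using bounded_op_diff[OF FY_bounded[OF K(1)] l(1) w(1)] by simp
    also have "l2norm \<dots> \<le> seqnorm K * l2norm (\<lambda>t. A n u t - w t)"
      by (rule seqnorm_bound[OF K(1) l2_diff(1)[OF l(1) w(1)]])
    finally show "l2norm (seq_mult K A n u) \<le> l2norm (K n w) + seqnorm K * l2norm (\<lambda>t. A n u t - w t)"
      by (simp add: seq_mult_def)
  qed simp
qed

text \<open>A norm estimate is uniform in n, so pointwise convergence to zero survives norm
  limits.\<close>

lemma strongly_null_approx:
  assumes A: "A \<in> FY Y"
    and approx: "\<And>\<epsilon>. \<epsilon> > 0 \<Longrightarrow> \<exists>X\<in>FY Y. strongly_null X \<and> seqnorm (seq_diff X A) \<le> \<epsilon>"
  shows "strongly_null A"
  unfolding strongly_null_def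
proof
  fix u :: "'a \<Rightarrow> complex" assume u: "u \<in> l2"
  show "(\<lambda>n. l2norm (A n u)) \<longlonglongrightarrow> 0"
  proof (rule LIMSEQ_I)
    fix r :: real assume r: "r > 0"
    \<comment> \<open>Chosen so that \<epsilon> times \<open>l2norm u + 1\<close> is r/2; the
      summand 1 avoids division by zero.\<close>
    define \<epsilon> where "\<epsilon> = r / (2 * (l2norm u + 1))"
    have c: "l2norm u + 1 > 0" by (simp add: add_nonneg_pos)
    have "\<epsilon> > 0" using r c by (simp add: \<epsilon>_def)
    then obtain X where X: "X \<in> FY Y" "strongly_null X" "seqnorm (seq_diff X A) \<le> \<epsilon>"
      using approx by blast
    have "(\<lambda>n. l2norm (X n u)) \<longlonglongrightarrow> 0" using X u by (simp add: strongly_null_def)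
    then obtain N where N: "\<And>n. n \<ge> N \<Longrightarrow> l2norm (X n u) < r / 2"
      using LIMSEQ_D[of "\<lambda>n. l2norm (X n u)" 0 "r / 2"] r by auto
    have "l2norm (A n u) < r" if "n \<ge> N" for n
    proof -
      have l: "A n u \<in> l2" "X n u \<in> l2" using FY_bounded[OF A] FY_bounded[OF X(1)] by simp_all
      have "l2norm (A n u) \<le> l2norm (X n u) + l2norm (seq_diff A X n u)"
        using l2norm_triangle_sub[OF l] by (simp add: seq_diff_def op_diff_def)
      also have "l2norm (seq_diff A X n u) \<le> seqnorm (seq_diff A X) * l2norm u"
        by (rule seqnorm_bound[OF FY_diff[OF A X(1)] u])
      also have "\<dots> \<le> \<epsilon> * (l2norm u + 1)"
        using X(3) \<open>\<epsilon> > 0\<close> by (intro mult_mono) (auto simp: seqnorm_diff_commute[of A])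
      also have "\<dots> = r / 2" using c by (simp add: \<epsilon>_def divide_simps)
      finally show ?thesis using N[OF that] by simp
    qed
    then show "\<exists>N. \<forall>n\<ge>N. norm (l2norm (A n u) - 0) < r" by auto
  qed
qed

lemma strongly_null_imp_convergent: "strongly_null A \<Longrightarrow> strongly_convergent A"
  unfolding strongly_null_def strongly_convergent_def by (auto intro!: bexI[of _ "\<lambda>_. 0"])

lemma strongly_convergent_add:
  assumes "A \<in> FY Y" "B \<in> FY Y" "strongly_convergent A" "strongly_convergent B"
  shows "strongly_convergent (seq_add A B)"
  unfolding strongly_convergent_def
proof
  fix u :: "'a \<Rightarrow> complex" assume u: "u \<in> l2"
  obtain v where v: "v \<in> l2" "(\<lambda>n. l2norm (\<lambda>t. A n u t - v t)) \<longlonglongrightarrow> 0"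
    using assms(3) u unfolding strongly_convergent_def by blast
  obtain w where w: "w \<in> l2" "(\<lambda>n. l2norm (\<lambda>t. B n u t - w t)) \<longlonglongrightarrow> 0"
    using assms(4) u unfolding strongly_convergent_def by blast
  have "(\<lambda>n. l2norm (\<lambda>t. seq_add A B n u t - (v t + w t))) \<longlonglongrightarrow> 0"
  proof (rule tendsto_zero_upper[OF tendsto_add_zero[OF v(2) w(2)]])
    fix n
    have "(\<lambda>t. A n u t - v t) \<in> l2" "(\<lambda>t. B n u t - w t) \<in> l2"
      using FY_bounded[OF assms(1)] FY_bounded[OF assms(2)] v w by (auto intro!: l2_diff)
    from l2_add(2)[OF this]
    show "l2norm (\<lambda>t. seq_add A B n u t - (v t + w t))
        \<le> l2norm (\<lambda>t. A n u t - v t) + l2norm (\<lambda>t. B n u t - w t)"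
      by (simp add: seq_add_def op_add_def algebra_simps)
  qed simp
  then show "\<exists>w\<in>l2. (\<lambda>n. l2norm (\<lambda>t. seq_add A B n u t - w t)) \<longlonglongrightarrow> 0"
    using l2_add(1)[OF v(1) w(1)] by (intro bexI[of _ "\<lambda>t. v t + w t"])
qed

section \<open>Strong limits along an exhaustion of the group\<close>

context
  fixes Y :: "nat \<Rightarrow> 'a::group_add set"
  assumes mono: "mono Y" and cover: "(\<Union>n. Y n) = UNIV"
begin

lemma finite_subset_exhaustion:
  assumes "finite F"
  shows "\<exists>N. \<forall>n\<ge>N. F \<subseteq> Y n"
  using assms
proof induction
  case (insert x F)
  then obtain N where N: "\<forall>n\<ge>N. F \<subseteq> Y n" by blast
  obtain m where m: "x \<in> Y m" using cover by blast
  have "insert x F \<subseteq> Y n" if "n \<ge> max N m" for n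
    using N m that monoD[OF mono, of m n] by auto
  then show ?case by blast
qed simp

lemma Q_op_strongly_null:
  assumes "u \<in> l2"
  shows "(\<lambda>n. l2norm (Q_op (Y n) u)) \<longlonglongrightarrow> 0"
proof (rule LIMSEQ_I)
  fix r :: real assume "r > 0"
  obtain F where F: "finite F" "\<And>X. F \<subseteq> X \<Longrightarrow> l2norm (\<lambda>t. u t - P_op X u t) < r"
    using l2_tail_small[OF assms \<open>r > 0\<close>] by blast
  then show "\<exists>N. \<forall>n\<ge>N. norm (l2norm (Q_op (Y n) u) - 0) < r"
    using finite_subset_exhaustion[OF F(1)] assms by (auto simp: Q_op_apply)
qed

text \<open>The error splits as Bu - PBPu = PBQu + QBu, and \<open>Q_op (Y n)\<close> tends strongly
  to zero.\<close>

lemma compress_strong_limit: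
  assumes B: "bounded_op B" and u: "u \<in> l2"
  shows "(\<lambda>n. l2norm (\<lambda>t. compress Y B n u t - B u t)) \<longlonglongrightarrow> 0"
proof -
  have "(\<lambda>n. opnorm B * l2norm (Q_op (Y n) u) + l2norm (Q_op (Y n) (B u))) \<longlonglongrightarrow> 0"
    using B u by (intro tendsto_add_zero tendsto_mult_right_zero Q_op_strongly_null) simp_all
  then show ?thesis
  proof (rule tendsto_zero_upper)
    fix n
    let ?P = "P_op (Y n)" and ?Q = "Q_op (Y n)"
    have "(\<lambda>t. B u t - compress Y B n u t) = (\<lambda>t. ?P (B (?Q u)) t + ?Q (B u) t)"
      using B u by (intro ext) (simp add: compress_def Q_op_apply bounded_op_diff)
    then have "l2norm (\<lambda>t. compress Y B n u t - B u t) = l2norm (\<lambda>t. ?P (B (?Q u)) t + ?Q (B u) t)"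
      using l2norm_minus_commute[of "compress Y B n u" "B u"] by simp
    also have "\<dots> \<le> l2norm (?P (B (?Q u))) + l2norm (?Q (B u))"
      by (intro l2_add) simp_all
    also have "l2norm (?P (B (?Q u))) \<le> l2norm (B (?Q u))"
      using B by (intro l2norm_P_op) simp
    also have "\<dots> \<le> opnorm B * l2norm (?Q u)"
      using B by (intro opnorm_bound) simp_all
    finally show "l2norm (\<lambda>t. compress Y B n u t - B u t) \<le> opnorm B * l2norm (?Q u) + l2norm (?Q (B u))"
      by simp
  qed simp
qed

lemma compress_strongly_convergent: "bounded_op B \<Longrightarrow> strongly_convergent (compress Y B)"
  unfolding strongly_convergent_def using compress_strong_limit[of B] bounded_op_l2[of B] by blast

text \<open>From Pu = u - Qu one gets QCPu = QCu - QCQu. Both terms tend to zero, and the remaining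
  factors are uniformly bounded.\<close>

lemma hankel_strongly_null:
  assumes B: "bounded_op B" and C: "bounded_op C"
  shows "strongly_null (hankel Y B C)"
  unfolding strongly_null_def
proof
  fix u :: "'a \<Rightarrow> complex" assume u: "u \<in> l2"
  have "(\<lambda>n. opnorm B * (l2norm (Q_op (Y n) (C u)) + opnorm C * l2norm (Q_op (Y n) u))) \<longlonglongrightarrow> 0"
    using C u by (intro tendsto_add_zero tendsto_mult_right_zero Q_op_strongly_null) simp_all
  then show "(\<lambda>n. l2norm (hankel Y B C n u)) \<longlonglongrightarrow> 0"
  proof (rule tendsto_zero_upper)
    fix n
    let ?P = "P_op (Y n)" and ?Q = "Q_op (Y n)"
    have "?P u = (\<lambda>t. u t - ?Q u t)" using u by (simp add: Q_op_apply)
    then have "C (?P u) = (\<lambda>t. C u t - C (?Q u) t)" using C u by (simp add: bounded_op_diff)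
    then have eq: "?Q (C (?P u)) = (\<lambda>t. ?Q (C u) t - ?Q (C (?Q u)) t)"
      using C by (simp add: bounded_op_diff)
    have "l2norm (?Q (C (?P u))) \<le> l2norm (?Q (C u)) + l2norm (?Q (C (?Q u)))"
      unfolding eq by (intro l2_diff) simp_all
    also have "l2norm (?Q (C (?Q u))) \<le> l2norm (C (?Q u))"
      using C by (intro l2norm_Q_op) simp
    also have "\<dots> \<le> opnorm C * l2norm (?Q u)"
      using C by (intro opnorm_bound) simp_all
    finally have Q: "l2norm (?Q (C (?P u))) \<le> l2norm (?Q (C u)) + opnorm C * l2norm (?Q u)"
      by simp
    have "l2norm (?P (B (?Q (C (?P u))))) \<le> l2norm (B (?Q (C (?P u))))"
      using B by (intro l2norm_P_op) simp
    also have "\<dots> \<le> opnorm B * l2norm (?Q (C (?P u)))"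
      using B by (intro opnorm_bound) simp_all
    also have "\<dots> \<le> opnorm B * (l2norm (?Q (C u)) + opnorm C * l2norm (?Q u))"
      using B Q by (intro mult_left_mono) simp_all
    finally show "l2norm (hankel Y B C n u) \<le> opnorm B * (l2norm (?Q (C u)) + opnorm C * l2norm (?Q u))"
      by (simp add: hankel_def)
  qed simp
qed

end

section \<open>The structure of the algebra of the finite sections method\<close>

text \<open>Requiring adjoints to lie in the ideal and to be strongly null makes this set self-adjoint
  without appealing to the self-adjointness of closed ideals in C*-algebras.\<close>

definition strong_null_part :: "'a opseq set \<Rightarrow> 'a opseq set" where
  "strong_null_part I = {K \<in> I. seq_adj K \<in> I \<and> strongly_null K \<and> strongly_null (seq_adj K)}"

text \<open>The candidate for a dense subalgebra of \<open>SY Y\<close>. It is closed under products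
  once \<open>J\<close> contains the Hankel corrections and is stable under multiplication by finite
  sections and by its own members.\<close>

definition sections_plus :: "(nat \<Rightarrow> 'a::group_add set) \<Rightarrow> 'a opseq set \<Rightarrow> 'a opseq set" where
  "sections_plus Y J = {seq_add (compress Y B) K | B K. B \<in> BDO \<and> K \<in> J}"

lemma sections_plusI: "B \<in> BDO \<Longrightarrow> K \<in> J \<Longrightarrow> seq_add (compress Y B) K \<in> sections_plus Y J"
  unfolding sections_plus_def by blast

section \<open>Approximation modulo a closed ideal containing the generators\<close>

context
  fixes Y :: "nat \<Rightarrow> 'a::group_add set" and \<Omega> :: "'a set" and I :: "'a opseq set"
  assumes mono: "mono Y" and cover: "(\<Union>n. Y n) = UNIV"
    and gen: "generates_semigroup \<Omega>" and ideal: "closed_ideal Y (SY Y) I"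
    and \<Omega>: "\<And>\<omega>. \<omega> \<in> \<Omega> \<Longrightarrow> hankel Y (shift_op (- \<omega>)) (shift_op \<omega>) \<in> I"
begin

lemma ideal_SY: "K \<in> I \<Longrightarrow> K \<in> SY Y"
  using closed_idealD(1)[OF ideal] by blast

lemma ideal_FY: "K \<in> I \<Longrightarrow> K \<in> FY Y"
  using ideal_SY SY_FY by blast

lemma hankel_ideal: "B \<in> BDO \<Longrightarrow> C \<in> BDO \<Longrightarrow> hankel Y B C \<in> I"
  using closed_ideal_contains_hankel[OF gen ideal \<Omega>] .

lemma strong_null_part_FY: "K \<in> strong_null_part I \<Longrightarrow> K \<in> FY Y"
  by (simp add: strong_null_part_def ideal_FY)

lemma strong_null_part_hankel:
  assumes "B \<in> BDO" "C \<in> BDO"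
  shows "hankel Y B C \<in> strong_null_part I"
  using assms
  by (simp add: strong_null_part_def hankel_ideal seq_adj_hankel BDO_adj hankel_strongly_null[OF mono cover])

lemma strong_null_part_zero: "zero_seq \<in> strong_null_part I"
proof -
  have "zero_seq \<in> I"
    by (rule closed_idealD(8)[OF ideal hankel_ideal[OF BDO_shift BDO_shift]])
  then show ?thesis by (simp add: strong_null_part_def seq_adj_zero strongly_null_zero)
qed

lemma strong_null_part_adj: "K \<in> strong_null_part I \<Longrightarrow> seq_adj K \<in> strong_null_part I"
  using strong_null_part_FY[of K] by (simp add: strong_null_part_def seq_adj_adj)

lemma strong_null_part_add:
  assumes "K \<in> strong_null_part I" "L \<in> strong_null_part I"
  shows "seq_add K L \<in> strong_null_part I"
  using assms strong_null_part_FY[OF assms(1)] strong_null_part_FY[OF assms(2)]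
  by (auto simp: strong_null_part_def seq_adj_add closed_idealD(2)[OF ideal]
      intro!: strongly_null_add[where Y = Y] FY_adj)

lemma strong_null_part_scale:
  assumes "K \<in> strong_null_part I"
  shows "seq_scale c K \<in> strong_null_part I"
  using assms strong_null_part_FY[OF assms]
  by (auto simp: strong_null_part_def seq_adj_scale closed_idealD(3)[OF ideal] intro!: strongly_null_scale)

text \<open>Strong convergence of \<open>X\<close> makes \<open>K X\<close> strongly null. For the
  adjoint X*K*, boundedness of X* suffices, since K* acts first.\<close>

lemma strong_null_part_mult_right:
  assumes K: "K \<in> strong_null_part I" and X: "X \<in> SY Y" "strongly_convergent X"
  shows "seq_mult K X \<in> strong_null_part I"
proof -
  have K': "K \<in> I" "seq_adj K \<in> I" "strongly_null K" "strongly_null (seq_adj K)"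
    using K by (simp_all add: strong_null_part_def)
  note F = strong_null_part_FY[OF K] SY_FY[OF X(1)]
  have "seq_mult K X \<in> I" "seq_mult (seq_adj X) (seq_adj K) \<in> I"
    using K' X SY_adj[OF X(1)] closed_idealD(4,5)[OF ideal] by blast+
  moreover have "strongly_null (seq_mult K X)"
    using strongly_null_mult_right[OF F(1) K'(3) F(2) X(2)] .
  moreover have "strongly_null (seq_mult (seq_adj X) (seq_adj K))"
    using strongly_null_mult_left[OF FY_adj(1)[OF F(2)] FY_adj(1)[OF F(1)] K'(4)] .
  ultimately show ?thesis by (simp add: strong_null_part_def seq_adj_mult[OF F])
qed

text \<open>XK is the adjoint of K*X*, which reduces the claim to multiplication on the
  right.\<close>

lemma strong_null_part_mult_left:
  assumes K: "K \<in> strong_null_part I" and X: "X \<in> SY Y" "strongly_convergent (seq_adj X)"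
  shows "seq_mult X K \<in> strong_null_part I"
proof -
  note F = strong_null_part_FY[OF K] SY_FY[OF X(1)]
  have "seq_mult X K = seq_adj (seq_mult (seq_adj K) (seq_adj X))"
    using F by (simp add: seq_adj_mult[of _ Y] FY_adj seq_adj_adj[of _ Y])
  then show ?thesis
    using strong_null_part_adj[OF strong_null_part_mult_right[OF strong_null_part_adj[OF K] SY_adj[OF X(1)] X(2)]] by simp
qed

text \<open>The product is grouped as a finite section of \<open>B \<circ> C\<close> plus
  corrections, each of which will be placed in the strongly null part.\<close>

lemma sections_plus_mult_eq:
  assumes "bounded_op B" "bounded_op C" "K \<in> FY Y" "L \<in> FY Y"
  shows "seq_mult (seq_add (compress Y B) K) (seq_add (compress Y C) L)
    = seq_add (compress Y (B \<circ> C))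
        (seq_add (seq_add (seq_scale (-1) (hankel Y B C)) (seq_mult (compress Y B) L))
          (seq_add (seq_mult K (compress Y C)) (seq_mult K L)))"
proof
  fix n
  have b: "bounded_op (K n)" "bounded_op (L n)" using assms by simp_all
  show "seq_mult (seq_add (compress Y B) K) (seq_add (compress Y C) L) n
    = seq_add (compress Y (B \<circ> C))
        (seq_add (seq_add (seq_scale (-1) (hankel Y B C)) (seq_mult (compress Y B) L))
          (seq_add (seq_mult K (compress Y C)) (seq_mult K L))) n"
    unfolding seq_mult_def seq_add_def seq_scale_def compress_def hankel_def
    by (rule bounded_op_eqI; (use assms(1,2) b in \<open>simp; fail\<close>)?;
        use assms(1,2) b in \<open>simp add: op_add_def op_scale_def Q_op_apply bounded_op_diff bounded_op_add\<close>)
qed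

lemma cstar_subalg_sections_plus: "cstar_subalg Y (sections_plus Y (strong_null_part I))"
proof -
  let ?M = "sections_plus Y (strong_null_part I)"
  have "?M \<subseteq> FY Y"
    unfolding sections_plus_def using strong_null_part_FY by (auto intro!: FY_add compress_FY)
  moreover have "seq_add X Z \<in> ?M" "seq_mult X Z \<in> ?M" if XZ: "X \<in> ?M" "Z \<in> ?M" for X Z
  proof -
    obtain B K where B: "X = seq_add (compress Y B) K" "B \<in> BDO" "K \<in> strong_null_part I"
      using XZ by (auto simp: sections_plus_def)
    obtain C L where C: "Z = seq_add (compress Y C) L" "C \<in> BDO" "L \<in> strong_null_part I"
      using XZ by (auto simp: sections_plus_def)
    have b: "bounded_op B" "bounded_op C" using B C by simp_all
    have "compress Y (op_add B C) = seq_add (compress Y B) (compress Y C)"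
      using b by (intro ext) (simp add: compress_def seq_add_def op_add_def bounded_op_add)
    then have "seq_add X Z = seq_add (compress Y (op_add B C)) (seq_add K L)"
      by (simp add: B(1) C(1) seq_add_def op_add_def algebra_simps)
    then show "seq_add X Z \<in> ?M"
      using B C by (simp add: sections_plusI strong_null_part_add)
    have "seq_mult (compress Y B) L \<in> strong_null_part I"
      using B C b
      by (intro strong_null_part_mult_left)
         (simp_all add: SY_compress seq_adj_compress compress_strongly_convergent[OF mono cover])
    moreover have "seq_mult K (compress Y C) \<in> strong_null_part I"
      using B C b
      by (intro strong_null_part_mult_right) (simp_all add: SY_compress compress_strongly_convergent[OF mono cover])
    moreover have "seq_mult K L \<in> strong_null_part I"
      using B C
      by (intro strong_null_part_mult_right strongly_null_imp_convergent) (auto simp: strong_null_part_def ideal_SY)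
    ultimately have "seq_add (seq_add (seq_scale (-1) (hankel Y B C)) (seq_mult (compress Y B) L))
          (seq_add (seq_mult K (compress Y C)) (seq_mult K L)) \<in> strong_null_part I"
      using B C by (intro strong_null_part_add strong_null_part_scale strong_null_part_hankel)
    moreover have "seq_mult X Z = seq_add (compress Y (B \<circ> C))
        (seq_add (seq_add (seq_scale (-1) (hankel Y B C)) (seq_mult (compress Y B) L))
          (seq_add (seq_mult K (compress Y C)) (seq_mult K L)))"
      unfolding B(1) C(1) using b strong_null_part_FY[OF B(3)] strong_null_part_FY[OF C(3)]
      by (rule sections_plus_mult_eq)
    ultimately show "seq_mult X Z \<in> ?M"
      using B(2) C(2) by (simp add: sections_plusI)
  qed
  moreover have "seq_scale c X \<in> ?M" "seq_adj X \<in> ?M" if X: "X \<in> ?M" for X c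
  proof -
    obtain B K where B: "X = seq_add (compress Y B) K" "B \<in> BDO" "K \<in> strong_null_part I"
      using X by (auto simp: sections_plus_def)
    have b: "bounded_op B" using B by simp
    have "compress Y (op_scale c B) = seq_scale c (compress Y B)"
      using b by (intro ext) (simp add: compress_def seq_scale_def op_scale_def bounded_op_scale)
    then have "seq_scale c X = seq_add (compress Y (op_scale c B)) (seq_scale c K)"
      by (simp add: B(1) seq_add_def seq_scale_def op_add_def op_scale_def algebra_simps)
    then show "seq_scale c X \<in> ?M"
      using B by (simp add: sections_plusI strong_null_part_scale)
    have "seq_adj X = seq_add (compress Y (op_adj B)) (seq_adj K)"
      unfolding B(1) seq_adj_add[OF compress_FY(1)[OF b] strong_null_part_FY[OF B(3)]]
      using b by (simp add: seq_adj_compress)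
    then show "seq_adj X \<in> ?M"
      using B by (simp add: sections_plusI strong_null_part_adj BDO_adj)
  qed
  ultimately show ?thesis by (simp add: cstar_subalg_def)
qed

text \<open>Minimality of \<open>SY Y\<close>: the closure of the sections plus corrections is a
  closed C*-subalgebra and contains every D(B), with correction \<open>zero_seq\<close>.\<close>

lemma SY_subset_closure: "SY Y \<subseteq> seq_closure Y (sections_plus Y (strong_null_part I))"
proof (rule SY_subset)
  show "cstar_subalg Y (seq_closure Y (sections_plus Y (strong_null_part I)))"
    by (rule cstar_subalg_seq_closure[OF cstar_subalg_sections_plus])
  show "seq_closed Y (seq_closure Y (sections_plus Y (strong_null_part I)))"
    using cstar_subalg_sections_plus by (intro seq_closed_seq_closure) (simp add: cstar_subalg_def)
  fix B :: "'a op" assume B: "B \<in> BDO"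
  have "compress Y B = seq_add (compress Y B) zero_seq"
    by (simp add: seq_add_def op_add_def zero_seq_def)
  then have "compress Y B \<in> sections_plus Y (strong_null_part I)"
    using sections_plusI[OF B strong_null_part_zero, of Y] by simp
  moreover have "seqnorm (seq_diff (compress Y B) (compress Y B)) \<le> 0"
    by (intro seqnorm_leI opnorm_leI) (simp_all add: seq_diff_def op_diff_def)
  ultimately show "compress Y B \<in> seq_closure Y (sections_plus Y (strong_null_part I))"
    using compress_FY(1)[OF BDO_bounded[OF B]] unfolding seq_closure_def
    by (auto intro!: bexI[of _ "compress Y B"])
qed

lemma SY_approx:
  assumes "A \<in> SY Y" "\<epsilon> > 0"
  obtains B K where "B \<in> BDO" "K \<in> strong_null_part I" "seqnorm (seq_diff (seq_add (compress Y B) K) A) \<le> \<epsilon>"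
proof -
  have "A \<in> seq_closure Y (sections_plus Y (strong_null_part I))" using assms SY_subset_closure by blast
  then obtain X where "X \<in> sections_plus Y (strong_null_part I)" "seqnorm (seq_diff X A) \<le> \<epsilon>"
    by (rule seq_closureD[OF _ assms(2)])
  then show ?thesis using that unfolding sections_plus_def by blast
qed

lemma JY_subset_ideal: "JY Y \<subseteq> I"
proof
  fix A assume "A \<in> JY Y"
  then have A: "A \<in> SY Y" "strongly_null A" by (simp_all add: JY_iff)
  note AF = SY_FY[OF A(1)]
  show "A \<in> I"
  \<comment> \<open>As \<open>I\<close> is closed, approximating \<open>A\<close> by members of
    \<open>I\<close> suffices. The approximant will be \<open>K\<close>, once the finite sections of
    \<open>B\<close> are shown to be small.\<close>
  proof (rule seq_closed_approx[OF closed_idealD(7)[OF ideal] _ AF])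
    show "I \<subseteq> FY Y" using ideal_FY by blast
    fix \<epsilon> :: real assume "\<epsilon> > 0"
    then obtain B K where B: "B \<in> BDO" and K: "K \<in> strong_null_part I"
      and le: "seqnorm (seq_diff (seq_add (compress Y B) K) A) \<le> \<epsilon> / 2"
      using SY_approx[OF A(1) half_gt_zero] by metis
    let ?D = "seq_diff (seq_add (compress Y B) K) A"
    have b: "bounded_op B" using B by simp
    note KF = strong_null_part_FY[OF K] and BF = compress_FY(1)[OF b, of Y]
    have DF: "?D \<in> FY Y" using AF KF BF by (intro FY_diff FY_add)
    have Kn: "strongly_null K" using K by (simp add: strong_null_part_def)
    \<comment> \<open>\<open>B\<close> is the strong limit of \<open>?D\<close>, hence as small as \<open>?D\<close> itself.\<close>
    have "opnorm B \<le> \<epsilon> / 2"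
    proof (rule opnorm_leI)
      fix u :: "'a \<Rightarrow> complex" assume u: "u \<in> l2"
      have "(\<lambda>n. l2norm (\<lambda>t. compress Y B n u t - B u t) + l2norm (K n u) + l2norm (A n u)) \<longlonglongrightarrow> 0"
        using Kn A(2) u
        by (intro tendsto_add_zero compress_strong_limit[OF mono cover b]) (simp_all add: strongly_null_def)
      \<comment> \<open>The next estimate holds for every n, and its right-hand side tends to
        \<open>\<epsilon> / 2 * l2norm u\<close>; passing to the limit bounds
        \<open>l2norm (B u)\<close>.\<close>
      then have "(\<lambda>n. \<epsilon> / 2 * l2norm u + (l2norm (\<lambda>t. compress Y B n u t - B u t) + l2norm (K n u) + l2norm (A n u)))
          \<longlonglongrightarrow> \<epsilon> / 2 * l2norm u + 0"
        by (intro tendsto_add tendsto_const)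
      moreover have "l2norm (B u) \<le> \<epsilon> / 2 * l2norm u
          + (l2norm (\<lambda>t. compress Y B n u t - B u t) + l2norm (K n u) + l2norm (A n u))" for n
      proof -
        let ?C = "compress Y B n u"
        have l: "B u \<in> l2" "?C \<in> l2" "K n u \<in> l2" "A n u \<in> l2" "?D n u \<in> l2"
          using b FY_bounded[OF BF, of n] FY_bounded[OF KF, of n] FY_bounded[OF AF, of n] FY_bounded[OF DF, of n]
          by simp_all
        have "l2norm (B u) \<le> l2norm ?C + l2norm (\<lambda>t. ?C t - B u t)"
          using l2norm_triangle_sub[OF l(1,2)] l2norm_minus_commute[of "B u" ?C] by simp
        moreover have "?C = (\<lambda>t. (?D n u t - K n u t) + A n u t)"
          by (simp add: seq_diff_def seq_add_def op_diff_def op_add_def)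
        then have "l2norm ?C \<le> l2norm (?D n u) + l2norm (K n u) + l2norm (A n u)"
          using l2_add(2)[OF l2_diff(1)[OF l(5,3)] l(4)] l2_diff(2)[OF l(5,3)] by simp
        moreover have "l2norm (?D n u) \<le> seqnorm ?D * l2norm u" by (rule seqnorm_bound[OF DF u])
        moreover have "\<dots> \<le> \<epsilon> / 2 * l2norm u" by (intro mult_right_mono le) simp
        ultimately show ?thesis by linarith
      qed
      ultimately show "l2norm (B u) \<le> \<epsilon> / 2 * l2norm u"
        using LIMSEQ_le_const[of _ "\<epsilon> / 2 * l2norm u" "l2norm (B u)"] by fastforce
    qed (use \<open>\<epsilon> > 0\<close> in simp)
    then have small: "seqnorm (compress Y B) \<le> \<epsilon> / 2" using compress_FY(2)[OF b, of Y] by linarith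
    \<comment> \<open>K - A is \<open>?D\<close> minus the finite sections of \<open>B\<close>, and
      each of these has norm at most \<epsilon>/2.\<close>
    have "seq_diff K A = seq_add ?D (seq_scale (-1) (compress Y B))"
      by (simp add: seq_diff_def seq_add_def seq_scale_def op_diff_def op_add_def op_scale_def)
    then have "seqnorm (seq_diff K A) \<le> seqnorm ?D + seqnorm (seq_scale (-1) (compress Y B))"
      using FY_add(2)[OF DF FY_scale(1)[OF BF]] by simp
    also have "\<dots> \<le> \<epsilon>" using FY_scale(2)[OF BF, of "-1"] small le by simp
    finally show "\<exists>X\<in>I. seqnorm (seq_diff X A) \<le> \<epsilon>"
      using K by (auto simp: strong_null_part_def)
  qed
qed

text \<open>The right factor is approximated by D(B) + K, which converges strongly. Multiplying by
  the fixed bounded sequence \<open>A\<close> preserves the approximation, so strong nullity follows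
  from \<open>strongly_null_approx\<close>.\<close>

lemma strongly_null_mult_SY:
  assumes A: "A \<in> FY Y" "strongly_null A" and X: "X \<in> SY Y"
  shows "strongly_null (seq_mult A X)"
proof (rule strongly_null_approx)
  note XF = SY_FY[OF X]
  show "seq_mult A X \<in> FY Y" by (rule FY_mult(1)[OF A(1) XF])
  fix \<epsilon> :: real assume \<epsilon>: "\<epsilon> > 0"
  have c: "seqnorm A + 1 > 0" using A by (simp add: add_nonneg_pos)
  obtain B K where B: "B \<in> BDO" and K: "K \<in> strong_null_part I"
    and le: "seqnorm (seq_diff (seq_add (compress Y B) K) X) \<le> \<epsilon> / (seqnorm A + 1)"
    by (rule SY_approx[OF X divide_pos_pos[OF \<epsilon> c]])
  let ?Z = "seq_add (compress Y B) K"
  have b: "bounded_op B" using B by simp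
  note KF = strong_null_part_FY[OF K] and BF = compress_FY(1)[OF b, of Y]
  have ZF: "?Z \<in> FY Y" by (rule FY_add(1)[OF BF KF])
  have "strongly_convergent ?Z"
    using K
    by (intro strongly_convergent_add[OF BF KF] compress_strongly_convergent[OF mono cover b]
        strongly_null_imp_convergent) (simp add: strong_null_part_def)
  then have "strongly_null (seq_mult A ?Z)" by (rule strongly_null_mult_right[OF A ZF])
  moreover have "seqnorm (seq_diff (seq_mult A ?Z) (seq_mult A X)) \<le> \<epsilon>"
  proof -
    have eq: "seq_diff (seq_mult A ?Z) (seq_mult A X) = seq_mult A (seq_diff ?Z X)"
    proof
      fix n
      have *: "bounded_op (A n)" "bounded_op (?Z n)" "bounded_op (X n)"
        using FY_bounded[OF A(1)] FY_bounded[OF ZF] FY_bounded[OF XF] by simp_all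
      show "seq_diff (seq_mult A ?Z) (seq_mult A X) n = seq_mult A (seq_diff ?Z X) n"
        unfolding seq_diff_def seq_mult_def
        by (rule bounded_op_eqI; (use * in \<open>simp; fail\<close>)?; use * in \<open>simp add: op_diff_def bounded_op_diff\<close>)
    qed
    have "seqnorm (seq_mult A (seq_diff ?Z X)) \<le> seqnorm A * seqnorm (seq_diff ?Z X)"
      by (rule FY_mult(2)[OF A(1) FY_diff[OF ZF XF]])
    also have "\<dots> \<le> (seqnorm A + 1) * (\<epsilon> / (seqnorm A + 1))"
      using le c seqnorm_nonneg[OF FY_diff[OF ZF XF]] by (intro mult_mono) auto
    also have "\<dots> = \<epsilon>" using c by simp
    finally show ?thesis by (simp only: eq)
  qed
  ultimately show "\<exists>X'\<in>FY Y. strongly_null X' \<and> seqnorm (seq_diff X' (seq_mult A X)) \<le> \<epsilon>"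
    using FY_mult(1)[OF A(1) ZF] by blast
qed

end

theorem mainTheorem3:
  fixes \<Omega> :: "'a::{group_add, countable} set"
    and Y :: "nat \<Rightarrow> 'a set"
  assumes "finite \<Omega>" and "0 \<in> \<Omega>" and "generates_semigroup \<Omega>"
    and "mono Y" and "\<And>n. finite (Y n)" and "(\<Union>n. Y n) = UNIV"
  shows "closed_ideal Y (SY Y) (JY Y)
    \<and> (\<forall>\<omega>\<in>\<Omega>. (\<lambda>n. P_op (Y n) \<circ> shift_op (- \<omega>) \<circ> Q_op (Y n) \<circ> shift_op \<omega> \<circ> P_op (Y n)) \<in> JY Y)
    \<and> (\<forall>I. closed_ideal Y (SY Y) I \<and>
           (\<forall>\<omega>\<in>\<Omega>. (\<lambda>n. P_op (Y n) \<circ> shift_op (- \<omega>) \<circ> Q_op (Y n) \<circ> shift_op \<omega> \<circ> P_op (Y n)) \<in> I)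
           \<longrightarrow> JY Y \<subseteq> I)"
proof -
  note gen = assms(3) and mono = assms(4) and cover = assms(6)
  \<comment> \<open>The whole algebra is a closed ideal of itself and contains all Hankel sequences,
    so the approximation results apply with \<open>I = SY Y\<close>. This supplies the right-ideal
    property of \<open>JY Y\<close>.\<close>
  have SI: "closed_ideal Y (SY Y) (SY Y)"
    by (simp add: closed_ideal_def SY_add SY_scale SY_mult SY_closed)
  have mult_right: "strongly_null (seq_mult A X)" if "A \<in> SY Y" "strongly_null A" "X \<in> SY Y" for A X
    using that by (intro strongly_null_mult_SY[OF mono cover gen SI] SY_hankel BDO_shift SY_FY)
  have "seq_closed Y (JY Y)"
    unfolding seq_closed_def
  proof (intro allI impI, elim conjE)
    fix f B
    assume f: "\<forall>k. f k \<in> JY Y" and B: "B \<in> FY Y" and lim: "(\<lambda>k. seqnorm (seq_diff (f k) B)) \<longlonglongrightarrow> 0"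
    have fS: "\<forall>k. f k \<in> SY Y" using f by (simp add: JY_iff)
    then have "B \<in> SY Y" using SY_closed[of Y] B lim unfolding seq_closed_def by blast
    moreover have "strongly_null B"
    proof (rule strongly_null_approx[OF B])
      fix \<epsilon> :: real assume "\<epsilon> > 0"
      then obtain k where "seqnorm (seq_diff (f k) B) < \<epsilon>" by (rule seq_closedE[OF lim])
      then show "\<exists>X\<in>FY Y. strongly_null X \<and> seqnorm (seq_diff X B) \<le> \<epsilon>"
        using f fS SY_FY by (intro bexI[of _ "f k"]) (auto simp: JY_iff)
    qed
    ultimately show "B \<in> JY Y" by (simp add: JY_iff)
  qed
  then have "closed_ideal Y (SY Y) (JY Y)"
    unfolding closed_ideal_def
    by (auto simp: JY_iff SY_add SY_scale SY_mult mult_right strongly_null_scale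
        strongly_null_add[of _ Y] strongly_null_mult_left[of _ Y] SY_FY)
  moreover have "\<forall>\<omega>\<in>\<Omega>. hankel Y (shift_op (- \<omega>)) (shift_op \<omega>) \<in> JY Y"
    by (simp add: JY_iff SY_hankel hankel_strongly_null[OF mono cover])
  moreover have "JY Y \<subseteq> I"
    if "closed_ideal Y (SY Y) I" "\<forall>\<omega>\<in>\<Omega>. hankel Y (shift_op (- \<omega>)) (shift_op \<omega>) \<in> I" for I
    using JY_subset_ideal[OF mono cover gen that(1)] that(2) by blast
  \<comment> \<open>The sequences in the theorem are Hankel sequences with their definition
    unfolded.\<close>
  ultimately show ?thesis unfolding hankel_def by blast
qed

end
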